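(* Let $X$ be a proper metric space with $\operatorname{trasind} X<\infty$ (i.e. $\operatorname{trasind}X\le\alpha$ for some ordinal $\alpha$). Then $\operatorname{asind} X<\infty$.
   Context: A metric space is proper if every closed ball is compact; each such space $X$ has a fixed base point $x_0$, with metric $d$. A map $\phi:X\to[0,1]$ is slowly oscillating if for every $r>0$ and $\varepsilon>0$ there is $D>0$ with $\operatorname{diam}\phi(B_r(x))<\varepsilon$ whenever $d(x,x_0)\ge D$. The Higson compactification $cX$ is the closure of the image of $X$ under $x\mapsto(\phi(x))_{\phi\in C_h(X)}\in[0,1]^{C_h(X)}$, where $C_h(X)$ is the set of continuous slowly oscillating maps $X\to[0,1]$; the Higson corona is $\nu X=cX\setminus X$. For $C\subset X$, $C'=\operatorname{cl}_{cX}C\cap\nu X$. A partition between disjoint closed sets $P,Q$ of a space $Z$ is a set $S\subset Z$ such that $Z\setminus S=U_1\cup U_2$ with $U_1,U_2$ disjoint open, $P\subset U_1$, $Q\subset U_2$. For $x\in\nu X$ and $A\subset X$ with $x\notin A'$, an asymptotic separator for $x$ and $A$ is $C\subset X$ with $C'$ a partition between $\{x\}$ and $A'$ in $\nu X$. $\operatorname{asind}X=-1$ iff $X$ is bounded; $\operatorname{asind}X\le n$ iff for every $x\in\nu X$ and $A\subset X$ with $x\notin A'$ there is an asymptotic separator $C$ for $x$ and $A$ with $\operatorname{asind}C\le n-1$; $\operatorname{asind}X=\infty$ if $\operatorname{asind}X\le n$ for no $n$. The transfinite version: $\operatorname{trasind} X=-1$ iff $X$ is bounded; for an ordinal $\alpha$,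 $\operatorname{trasind} X\le\alpha$ iff for every $x\in\nu X$ and $A\subset X$ with $x\notin A'$ there is an asymptotic separator $C$ for $x$ and $A$ with $\operatorname{trasind} C\le\beta$ for some $\beta<\alpha$; $\operatorname{trasind} X=\infty$ if $\operatorname{trasind} X\le\alpha$ holds for no ordinal $\alpha$. (Subsets carry the restricted metric.) *)

theory Defs
  imports "HOL-Analysis.Analysis"
begin

text \<open>A metric space is given by a carrier set S and a distance d (locale Metric_space);
  subsets carry the restricted metric, i.e. (C, d) for C a subset of S.
  x0 is the base point of the ambient space.\<close>

definition proper_mspace :: "'a set \<Rightarrow> ('a \<Rightarrow> 'a \<Rightarrow> real) \<Rightarrow> bool" where
  "proper_mspace S d \<longleftrightarrow> Metric_space S d \<and>
     (\<forall>x\<in>S. \<forall>r. compactin (Metric_space.mtopology S d) (Metric_space.mcball S d x r))"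

definition slowly_osc :: "'a set \<Rightarrow> ('a \<Rightarrow> 'a \<Rightarrow> real) \<Rightarrow> 'a \<Rightarrow> ('a \<Rightarrow> real) \<Rightarrow> bool" where
  "slowly_osc S d x0 \<phi> \<longleftrightarrow>
     (\<forall>r>0. \<forall>\<epsilon>>0. \<exists>D>0. \<forall>x\<in>S. d x x0 \<ge> D \<longrightarrow>
        diameter (\<phi> ` Metric_space.mball S d x r) < \<epsilon>)"

definition Ch :: "'a set \<Rightarrow> ('a \<Rightarrow> 'a \<Rightarrow> real) \<Rightarrow> 'a \<Rightarrow> ('a \<Rightarrow> real) set" where
  "Ch S d x0 = {\<phi>. \<phi> \<in> S \<rightarrow>\<^sub>E {0..1} \<and>
      continuous_map (Metric_space.mtopology S d) euclideanreal \<phi> \<and> slowly_osc S d x0 \<phi>}"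

definition higson_emb :: "'a set \<Rightarrow> ('a \<Rightarrow> 'a \<Rightarrow> real) \<Rightarrow> 'a \<Rightarrow> 'a \<Rightarrow> (('a \<Rightarrow> real) \<Rightarrow> real)" where
  "higson_emb S d x0 x = (\<lambda>\<phi>\<in>Ch S d x0. \<phi> x)"

definition higson_cube :: "'a set \<Rightarrow> ('a \<Rightarrow> 'a \<Rightarrow> real) \<Rightarrow> 'a \<Rightarrow> (('a \<Rightarrow> real) \<Rightarrow> real) topology" where
  "higson_cube S d x0 = product_topology (\<lambda>_. top_of_set {0..1}) (Ch S d x0)"

definition higson_compact :: "'a set \<Rightarrow> ('a \<Rightarrow> 'a \<Rightarrow> real) \<Rightarrow> 'a \<Rightarrow> (('a \<Rightarrow> real) \<Rightarrow> real) set" where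
  "higson_compact S d x0 = higson_cube S d x0 closure_of (higson_emb S d x0 ` S)"

definition higson_corona :: "'a set \<Rightarrow> ('a \<Rightarrow> 'a \<Rightarrow> real) \<Rightarrow> 'a \<Rightarrow> (('a \<Rightarrow> real) \<Rightarrow> real) set" where
  "higson_corona S d x0 = higson_compact S d x0 - higson_emb S d x0 ` S"

definition corona_trace :: "'a set \<Rightarrow> ('a \<Rightarrow> 'a \<Rightarrow> real) \<Rightarrow> 'a \<Rightarrow> 'a set \<Rightarrow> (('a \<Rightarrow> real) \<Rightarrow> real) set" where
  "corona_trace S d x0 C =
     (subtopology (higson_cube S d x0) (higson_compact S d x0) closure_of (higson_emb S d x0 ` C))
       \<inter> higson_corona S d x0"

definition is_partition :: "'b topology \<Rightarrow> 'b set \<Rightarrow> 'b set \<Rightarrow> 'b set \<Rightarrow> 'b set \<Rightarrow> bool" where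
  "is_partition T Z P Q Sep \<longleftrightarrow> Sep \<subseteq> Z \<and>
     (\<exists>U1 U2. openin (subtopology T Z) U1 \<and> openin (subtopology T Z) U2 \<and>
        U1 \<inter> U2 = {} \<and> Z - Sep = U1 \<union> U2 \<and> P \<subseteq> U1 \<and> Q \<subseteq> U2)"

definition asym_separator :: "'a set \<Rightarrow> ('a \<Rightarrow> 'a \<Rightarrow> real) \<Rightarrow> 'a \<Rightarrow> (('a \<Rightarrow> real) \<Rightarrow> real) \<Rightarrow> 'a set \<Rightarrow> 'a set \<Rightarrow> bool" where
  "asym_separator S d x0 x A C \<longleftrightarrow> C \<subseteq> S \<and>
     is_partition (higson_cube S d x0) (higson_corona S d x0) {x}
        (corona_trace S d x0 A) (corona_trace S d x0 C)"

inductive asind_le :: "('a \<Rightarrow> 'a \<Rightarrow> real) \<Rightarrow> 'a \<Rightarrow> int \<Rightarrow> 'a set \<Rightarrow> bool"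
  for d :: "'a \<Rightarrow> 'a \<Rightarrow> real" and x0 :: 'a where
  bounded: "n \<ge> -1 \<Longrightarrow> Metric_space.mbounded S d S \<Longrightarrow> asind_le d x0 n S"
| sep: "n \<ge> 0 \<Longrightarrow>
     (\<forall>x A. x \<in> higson_corona S d x0 \<and> A \<subseteq> S \<and> x \<notin> corona_trace S d x0 A \<longrightarrow>
        (\<exists>C. asym_separator S d x0 x A C \<and> asind_le d x0 (n - 1) C))
     \<Longrightarrow> asind_le d x0 n S"

text \<open>trasind_le d x0 \<alpha> S means trasind (S,d) \<le> \<alpha>, ordinals being elements of a well-order.\<close>
inductive trasind_le :: "('a \<Rightarrow> 'a \<Rightarrow> real) \<Rightarrow> 'a \<Rightarrow> 'b::wellorder \<Rightarrow> 'a set \<Rightarrow> bool"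
  for d :: "'a \<Rightarrow> 'a \<Rightarrow> real" and x0 :: 'a where
  bounded: "Metric_space.mbounded S d S \<Longrightarrow> trasind_le d x0 \<alpha> S"
| sep: "(\<forall>x A. x \<in> higson_corona S d x0 \<and> A \<subseteq> S \<and> x \<notin> corona_trace S d x0 A \<longrightarrow>
        (\<exists>C \<beta>. \<beta> < \<alpha> \<and> asym_separator S d x0 x A C \<and> trasind_le d x0 \<beta> C))
     \<Longrightarrow> trasind_le d x0 \<alpha> S"

end

theory Submission
  imports Defs
begin

text \<open>
  Replace X by a maximal 1-separated subset N; subsets of X and of N at bounded Hausdorff distance
  have the same trace at infinity, so it is enough to treat subsets of N, on which every function is
  continuous and the corona is compact. By induction on the ordinal, every pair (x, A) in N has a
  separator of finite dimension, and only a uniform bound is missing. If there were none, there would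
  be pairs (x_n, A_n) without separators of dimension at most n. The x_n can be taken either all equal
  or distinct from one of their cluster points, and then, after thinning out, they have pairwise
  disjoint neighbourhoods. In both cases one finds functions g_n with g_n(x_n) = 0 and g_n = 1 on the
  trace of A_n whose shells 1/2 \<le> g_n \<le> 2/3 are pairwise asymptotically disjoint. A diagonal choice
  collects infinitely many of these shells in one set Q whose trace misses x, the common value or a
  cluster point of the x_n. A separator C of x and Q has some finite dimension m, and the part of C
  inside the n-th shell is asymptotically clopen in C, hence still of dimension at most m; for suitable
  n \<ge> m it separates x_n from A_n, a contradiction.
\<close>

section \<open>Slowly oscillating functions and asymptotic disjointness\<close>

text \<open>The definitions run through arbitrary subsets, each with a corona of its own, and such
  subsets need not be closed. Subsets of a net are again nets, so the recursion can stay among them,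
  and there traces are governed by asymptotic disjointness. The two passages differ. From X down to
  N, separators are pulled back along a continuous map of coronas, at every level of the recursion.
  From N up to X, partitions are pushed forward, which needs a homeomorphism of coronas, but only
  once: the dimension of a separator does not depend on the ambient space. A separator of x and Q
  knows nothing about A_n. The shell repairs this: corona points with g_n = 7/12 lie in the trace of
  Q, hence in the outer open set, so the partition can be cut along this level. The shells may
  accumulate at x, and yet x must stay off the trace of Q. If all x_n equal x, the even and the odd
  shells get disjoint traces, so one family misses x. If the x_n are distinct from x, the cores g_n
  \<le> 1/3 are kept asymptotically disjoint from all shells; the trace of their union contains
  every chosen x_n, which keeps each cluster point of these off Q.\<close>

lemma openin_product_interval_basis:
  fixes y :: "'i \<Rightarrow> real"
  assumes "openin (product_topology (\<lambda>_. top_of_set {0..1}) I) U" "y \<in> U"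
  obtains F \<epsilon> where "finite F" "F \<subseteq> I" "\<epsilon> > 0"
    "\<And>z. \<lbrakk>z \<in> I \<rightarrow>\<^sub>E {0..1}; \<forall>i\<in>F. \<bar>z i - y i\<bar> < \<epsilon>\<rbrakk> \<Longrightarrow> z \<in> U"
proof -
  have "\<exists>V. finite {i \<in> I. V i \<noteq> topspace (top_of_set {0..1::real})} \<and>
      (\<forall>i\<in>I. openin (top_of_set {0..1}) (V i)) \<and> y \<in> Pi\<^sub>E I V \<and> Pi\<^sub>E I V \<subseteq> U"
    by (rule bspec[OF assms(1)[unfolded openin_product_topology_alt] assms(2)])
  then obtain V where V: "finite {i \<in> I. V i \<noteq> topspace (top_of_set {0..1::real})}"
      "\<And>i. i \<in> I \<Longrightarrow> openin (top_of_set {0..1}) (V i)" "y \<in> Pi\<^sub>E I V" "Pi\<^sub>E I V \<subseteq> U"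
    by (elim exE conjE) (rule that, auto)
  define F where "F = {i \<in> I. V i \<noteq> {0..1}}"
  have fin: "finite F" using V(1) by (simp add: F_def)
  have "\<exists>e>0. \<forall>t\<in>{0..1}. \<bar>t - y i\<bar> < e \<longrightarrow> t \<in> V i" if "i \<in> F" for i
  proof -
    have "i \<in> I" using that F_def by auto
    then have "openin (top_of_set {0..1}) (V i)" "y i \<in> V i" using V by auto
    then show ?thesis
      unfolding openin_euclidean_subtopology_iff dist_real_def by blast
  qed
  then obtain e where e: "\<And>i. i \<in> F \<Longrightarrow> e i > 0"
     "\<And>i t. \<lbrakk>i \<in> F; t \<in> {0..1}; \<bar>t - y i\<bar> < e i\<rbrakk> \<Longrightarrow> t \<in> V i"
    by metis
  define \<epsilon> where "\<epsilon> = Min (insert 1 (e ` F))"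
  have \<epsilon>: "\<epsilon> > 0" "\<And>i. i \<in> F \<Longrightarrow> \<epsilon> \<le> e i"
    using fin e by (auto simp: \<epsilon>_def)
  show thesis
  proof (rule that[of F \<epsilon>])
    fix z assume z: "z \<in> I \<rightarrow>\<^sub>E {0..1}" "\<forall>i\<in>F. \<bar>z i - y i\<bar> < \<epsilon>"
    have "z i \<in> V i" if "i \<in> I" for i
    proof (cases "i \<in> F")
      case True
      then have "\<bar>z i - y i\<bar> < e i" using z \<epsilon> by fastforce
      then show ?thesis using e(2)[OF True, of "z i"] PiE_mem[OF z(1) that] by auto
    next
      case False
      then show ?thesis using z that by (auto simp: F_def)
    qed
    then have "z \<in> Pi\<^sub>E I V" using z by (simp add: PiE_iff)
    then show "z \<in> U" using V(4) by blast
  qed (use fin \<epsilon> in \<open>auto simp: F_def\<close>)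
qed

lemma diameter_image_less:
  fixes f :: "'a \<Rightarrow> real"
  assumes "\<And>s t. \<lbrakk>s \<in> B; t \<in> B\<rbrakk> \<Longrightarrow> \<bar>f s - f t\<bar> \<le> e" "e \<ge> 0" "e < c"
  shows "diameter (f ` B) < c"
proof -
  have "diameter (f ` B) \<le> e"
    by (rule diameter_le) (use assms in auto)
  then show ?thesis using assms by linarith
qed

lemma ratio_mono:
  fixes t R :: real
  assumes "0 \<le> t" "t \<le> R" shows "t / (1 + t) \<le> R / (1 + R)"
  using assms by (simp add: field_simps)

locale based_metric_space = Metric_space X d for X :: "'a set" and d +
  fixes x0 :: 'a
  assumes base_in: "x0 \<in> X"
begin

abbreviation "CH S \<equiv> Ch S d x0"
abbreviation "emb S \<equiv> higson_emb S d x0"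
abbreviation "cube S \<equiv> higson_cube S d x0"
abbreviation "cpt S \<equiv> higson_compact S d x0"
abbreviation "cor S \<equiv> higson_corona S d x0"
abbreviation "tr S \<equiv> corona_trace S d x0"

abbreviation nm :: "'a \<Rightarrow> real" where "nm s \<equiv> d s x0"

lemma sub_Metric: "S \<subseteq> X \<Longrightarrow> Metric_space S d"
  using subspace by blast

lemma nm_triangle: "\<lbrakk>s \<in> X; t \<in> X\<rbrakk> \<Longrightarrow> nm s \<le> d s t + nm t"
  using triangle base_in by blast

lemma mbounded_iff_nm:
  assumes "S \<subseteq> X"
  shows "Metric_space.mbounded S d S \<longleftrightarrow> (\<exists>R. \<forall>s\<in>S. nm s \<le> R)"
proof -
  interpret S: Metric_space S d using sub_Metric assms by blast
  show ?thesis
  proof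
    assume "S.mbounded S"
    then obtain x B where "S \<subseteq> S.mcball x B" using S.mbounded_def by blast
    then have "\<forall>s\<in>S. x \<in> S \<and> d x s \<le> B" by auto
    then have "\<forall>s\<in>S. nm s \<le> B + nm x"
      using nm_triangle assms by (smt (verit) S.commute subsetD)
    then show "\<exists>R. \<forall>s\<in>S. nm s \<le> R" by blast
  next
    assume "\<exists>R. \<forall>s\<in>S. nm s \<le> R"
    then obtain R where R: "\<forall>s\<in>S. nm s \<le> R" by blast
    show "S.mbounded S"
    proof (cases "S = {}")
      case False
      then obtain x where x: "x \<in> S" by blast
      have "S \<subseteq> S.mcball x (R + R)"
      proof
        fix s assume s: "s \<in> S"
        have "d x s \<le> nm x + d x0 s" using triangle x s assms base_in by blast
        then show "s \<in> S.mcball x (R + R)" using x s R[rule_format, OF x] R[rule_format, OF s]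
          by (simp add: commute)
      qed
      then show ?thesis using S.mbounded_def by blast
    next
      case True
      then show ?thesis unfolding S.mbounded_def by blast
    qed
  qed
qed

text \<open>The range condition makes images of balls bounded, so that \<open>diameter\<close>
  really dominates the distances inside them.\<close>

lemma slowly_osc_iff:
  assumes "S \<subseteq> X" "\<phi> \<in> S \<rightarrow> {0..1}"
  shows "slowly_osc S d x0 \<phi> \<longleftrightarrow>
    (\<forall>r \<epsilon>. r > 0 \<longrightarrow> \<epsilon> > 0 \<longrightarrow> (\<exists>D. \<forall>s\<in>S. \<forall>t\<in>S. nm s \<ge> D \<longrightarrow> d s t < r \<longrightarrow> \<bar>\<phi> s - \<phi> t\<bar> < \<epsilon>))"
proof -
  interpret S: Metric_space S d using sub_Metric assms by blast
  show ?thesis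
  proof (intro iffI allI impI)
    fix r \<epsilon> :: real assume so: "slowly_osc S d x0 \<phi>" and pos: "r > 0" "\<epsilon> > 0"
    then obtain D where D: "\<And>x. \<lbrakk>x \<in> S; nm x \<ge> D\<rbrakk> \<Longrightarrow> diameter (\<phi> ` S.mball x r) < \<epsilon>"
      unfolding slowly_osc_def by meson
    have "\<bar>\<phi> s - \<phi> t\<bar> < \<epsilon>" if "s \<in> S" "t \<in> S" "nm s \<ge> D" "d s t < r" for s t
    proof -
      have "bounded (\<phi> ` S.mball s r)"
        by (rule bounded_subset[of "{0..1}"]) (use assms(2) in auto)
      then have "dist (\<phi> s) (\<phi> t) \<le> diameter (\<phi> ` S.mball s r)"
        by (rule diameter_bounded_bound) (use that pos in auto)
      then show ?thesis using D[of s] that by (simp add: dist_real_def)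
    qed
    then show "\<exists>D. \<forall>s\<in>S. \<forall>t\<in>S. nm s \<ge> D \<longrightarrow> d s t < r \<longrightarrow> \<bar>\<phi> s - \<phi> t\<bar> < \<epsilon>" by blast
  next
    assume *: "\<forall>r \<epsilon>. r > 0 \<longrightarrow> \<epsilon> > 0 \<longrightarrow> (\<exists>D. \<forall>s\<in>S. \<forall>t\<in>S. nm s \<ge> D \<longrightarrow> d s t < r \<longrightarrow> \<bar>\<phi> s - \<phi> t\<bar> < \<epsilon>)"
    show "slowly_osc S d x0 \<phi>"
      unfolding slowly_osc_def
    proof (intro allI impI)
      fix r \<epsilon> :: real assume "r > 0" "\<epsilon> > 0"
      \<comment> \<open>Two points of a ball are compared through its centre, which costs twice
        \<epsilon>/4; the remaining slack keeps the supremum strictly below \<epsilon>.\<close>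
      then obtain D where D: "\<And>s t. \<lbrakk>s \<in> S; t \<in> S; nm s \<ge> D; d s t < r\<rbrakk> \<Longrightarrow> \<bar>\<phi> s - \<phi> t\<bar> < \<epsilon>/4"
        using * by (metis divide_pos_pos zero_less_numeral)
      have "diameter (\<phi> ` S.mball x r) < \<epsilon>" if "x \<in> S" "nm x \<ge> max D 1" for x
      proof (rule diameter_image_less)
        fix s t assume "s \<in> S.mball x r" "t \<in> S.mball x r"
        then have "\<bar>\<phi> x - \<phi> s\<bar> < \<epsilon>/4" "\<bar>\<phi> x - \<phi> t\<bar> < \<epsilon>/4" using D[of x] that by auto
        then show "\<bar>\<phi> s - \<phi> t\<bar> \<le> \<epsilon>/2" by linarith
      qed (use \<open>\<epsilon> > 0\<close> in auto)
      then show "\<exists>D>0. \<forall>x\<in>S. nm x \<ge> D \<longrightarrow> diameter (\<phi> ` S.mball x r) < \<epsilon>"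
        by (intro exI[of _ "max D 1"]) auto
    qed
  qed
qed

lemma ChD_range: "\<phi> \<in> CH S \<Longrightarrow> s \<in> S \<Longrightarrow> \<phi> s \<in> {0..1}"
  unfolding Ch_def by auto

lemma ChD_restrict: "\<phi> \<in> CH S \<Longrightarrow> restrict \<phi> S = \<phi>"
  unfolding Ch_def by (auto simp: PiE_def extensional_restrict)

lemma ChD_osc:
  assumes "S \<subseteq> X" "\<phi> \<in> CH S" "\<epsilon> > 0"
  obtains D where "\<And>s t. \<lbrakk>s \<in> S; t \<in> S; nm s \<ge> D; d s t \<le> r\<rbrakk> \<Longrightarrow> \<bar>\<phi> s - \<phi> t\<bar> < \<epsilon>"
proof -
  have "\<phi> \<in> S \<rightarrow> {0..1}" "slowly_osc S d x0 \<phi>" using assms(2) by (auto simp: Ch_def)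
  then obtain D where "\<forall>s\<in>S. \<forall>t\<in>S. nm s \<ge> D \<longrightarrow> d s t < max (r+1) 1 \<longrightarrow> \<bar>\<phi> s - \<phi> t\<bar> < \<epsilon>"
    using slowly_osc_iff[OF assms(1)] assms(3) by (metis less_max_iff_disj zero_less_one)
  then show thesis by (intro that[of D]) auto
qed

lemma ChI:
  assumes "S \<subseteq> X" "\<phi> \<in> S \<rightarrow>\<^sub>E {0..1}"
    and cont: "\<And>a \<epsilon>. \<lbrakk>a \<in> S; \<epsilon> > 0\<rbrakk> \<Longrightarrow> \<exists>\<delta>>0. \<forall>t\<in>S. d a t < \<delta> \<longrightarrow> \<bar>\<phi> a - \<phi> t\<bar> < \<epsilon>"
    and osc: "\<And>r \<epsilon>. \<lbrakk>r > 0; \<epsilon> > 0\<rbrakk> \<Longrightarrow> \<exists>D. \<forall>s\<in>S. \<forall>t\<in>S. nm s \<ge> D \<longrightarrow> d s t < r \<longrightarrow> \<bar>\<phi> s - \<phi> t\<bar> < \<epsilon>"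
  shows "\<phi> \<in> CH S"
proof -
  interpret S: Metric_space S d using sub_Metric assms by blast
  have "continuous_map S.mtopology euclideanreal \<phi>"
    using S.metric_continuous_map[OF Met_TC.Metric_space_axioms, of \<phi>] cont
    by (simp add: dist_real_def Ball_def imp_conjL)
  moreover have "slowly_osc S d x0 \<phi>"
    using slowly_osc_iff[OF assms(1), of \<phi>] assms(2) osc by (auto simp: PiE_iff Pi_iff)
  ultimately show ?thesis using assms by (simp add: Ch_def)
qed

text \<open>The quotient varies between \<open>s\<close> and \<open>t\<close> by at most
  \<open>3 * d s t\<close> over the denominator at \<open>s\<close>. The summand 1 bounds
  denominators from below and gives continuity; the growth of \<open>f + g\<close> gives slow
  oscillation.\<close>

lemma Ch_ratio:
  assumes S: "S \<subseteq> X"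
    and f: "\<And>s. s \<in> S \<Longrightarrow> f s \<ge> 0" "\<And>s t. \<lbrakk>s \<in> S; t \<in> S\<rbrakk> \<Longrightarrow> \<bar>f s - f t\<bar> \<le> d s t"
    and g: "\<And>s. s \<in> S \<Longrightarrow> g s \<ge> 0" "\<And>s t. \<lbrakk>s \<in> S; t \<in> S\<rbrakk> \<Longrightarrow> \<bar>g s - g t\<bar> \<le> d s t"
    and big: "\<And>L. \<exists>D. \<forall>s\<in>S. nm s \<ge> D \<longrightarrow> f s + g s \<ge> L"
  shows "(\<lambda>s\<in>S. f s / (1 + f s + g s)) \<in> CH S" (is "?\<phi> \<in> _")
proof -
  have lip: "\<bar>f s / (1 + f s + g s) - f t / (1 + f t + g t)\<bar> \<le> 3 * d s t / (1 + f s + g s)"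
    if "s \<in> S" "t \<in> S" for s t
  proof -
    define D where "D = 1 + f s + g s"
    define D' where "D' = 1 + f t + g t"
    have pos: "D > 0" "D' > 0" "f t \<le> D'" "f t \<ge> 0"
      using f(1) g(1) that by (fastforce simp: D_def D'_def)+
    have dd: "\<bar>f s - f t\<bar> \<le> d s t" "\<bar>D' - D\<bar> \<le> 2 * d s t"
      using f(2)[OF that] g(2)[OF that] by (auto simp: D_def D'_def)
    \<comment> \<open>The factor \<open>f t / D'\<close> is at most 1, so the numerator contributes
      \<open>d s t\<close> and the denominator \<open>2 * d s t\<close>: this is the constant
      3.\<close>
    have eq: "f s / D - f t / D' = (f s - f t) / D + (f t / D') * ((D' - D) / D)"
      using pos by (simp add: field_simps)
    have "\<bar>(f t / D') * ((D' - D) / D)\<bar> \<le> 1 * (2 * d s t / D)"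
      unfolding abs_mult using pos dd
      by (intro mult_mono) (auto simp: divide_right_mono abs_divide)
    moreover have "\<bar>(f s - f t) / D\<bar> \<le> d s t / D"
      using pos dd by (auto simp: abs_divide divide_right_mono)
    ultimately have "\<bar>f s / D - f t / D'\<bar> \<le> d s t / D + 2 * d s t / D"
      unfolding eq by (intro order_trans[OF abs_triangle_ineq] add_mono) auto
    then show ?thesis by (simp add: D_def D'_def add_divide_distrib[symmetric])
  qed
  show ?thesis
  proof (rule ChI[OF S])
    show "?\<phi> \<in> S \<rightarrow>\<^sub>E {0..1}"
      using f(1) g(1) by (auto simp: divide_le_eq_1 add_nonneg_nonneg)
        (smt (verit) f(1) g(1))+
  next
    fix a \<epsilon> assume a: "a \<in> S" and "(\<epsilon>::real) > 0"
    have "\<bar>?\<phi> a - ?\<phi> t\<bar> < \<epsilon>" if "t \<in> S" "d a t < \<epsilon>/3" for t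
    proof -
      have "3 * d a t / (1 + f a + g a) \<le> 3 * d a t / 1"
        using f(1)[OF a] g(1)[OF a] by (intro divide_left_mono) auto
      then show ?thesis using lip[OF a that(1)] a that by simp
    qed
    then show "\<exists>\<delta>>0. \<forall>t\<in>S. d a t < \<delta> \<longrightarrow> \<bar>?\<phi> a - ?\<phi> t\<bar> < \<epsilon>"
      using \<open>\<epsilon> > 0\<close> by (intro exI[of _ "\<epsilon>/3"]) auto
  next
    fix r \<epsilon> :: real assume "r > 0" "\<epsilon> > 0"
    obtain D where D: "\<forall>s\<in>S. nm s \<ge> D \<longrightarrow> f s + g s \<ge> 3 * r / \<epsilon>" using big by blast
    have "\<bar>?\<phi> s - ?\<phi> t\<bar> < \<epsilon>" if "s \<in> S" "t \<in> S" "nm s \<ge> D" "d s t < r" for s t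
    proof -
      have "3 * r / \<epsilon> \<le> f s + g s" using D that by blast
      then have "3 * r \<le> \<epsilon> * (f s + g s)" using \<open>\<epsilon> > 0\<close> by (simp add: field_simps)
      then have "3 * d s t < \<epsilon> * (1 + f s + g s)" using \<open>\<epsilon> > 0\<close> that by (simp add: algebra_simps)
      moreover have "1 + f s + g s > 0" using f(1) g(1) that by (smt (verit))
      ultimately have "3 * d s t / (1 + f s + g s) < \<epsilon>" by (simp add: divide_less_eq)
      then show ?thesis using lip[OF that(1,2)] that by simp
    qed
    then show "\<exists>D. \<forall>s\<in>S. \<forall>t\<in>S. nm s \<ge> D \<longrightarrow> d s t < r \<longrightarrow> \<bar>?\<phi> s - ?\<phi> t\<bar> < \<epsilon>" by blast
  qed
qed

text \<open>The \<open>+ 0\<close> matches \<open>Ch_ratio\<close> with a vanishing second function.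
  This coordinate stays below 1 on \<open>S\<close> and tends to 1 as the norm grows, so the value 1
  marks the points of the compactification that lie at infinity.\<close>

definition radial :: "'a set \<Rightarrow> 'a \<Rightarrow> real" where
  "radial S = (\<lambda>s\<in>S. nm s / (1 + nm s + 0))"

lemma radial_in_Ch: "S \<subseteq> X \<Longrightarrow> radial S \<in> CH S"
  unfolding radial_def
proof (rule Ch_ratio)
  fix s t assume "S \<subseteq> X" "s \<in> S" "t \<in> S"
  then show "\<bar>nm s - nm t\<bar> \<le> d s t"
    using nm_triangle[of s t] nm_triangle[of t s] commute[of s t] by (auto simp: abs_le_iff subset_iff)
qed auto

lemma radial_less_1: "s \<in> S \<Longrightarrow> radial S s < 1"
  by (simp add: radial_def add_pos_nonneg)

lemma radial_greater:
  assumes "s \<in> S" "R \<ge> 0" "radial S s > R / (1 + R)"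
  shows "nm s > R"
proof (rule ccontr)
  assume "\<not> nm s > R"
  then have "nm s / (1 + nm s) \<le> R / (1 + R)"
    using ratio_mono[of "nm s" R] by simp
  then show False using assms by (simp add: radial_def)
qed

lemma radial_tends:
  assumes "\<epsilon> > 0" "s \<in> S" "nm s \<ge> 1 / \<epsilon>"
  shows "radial S s > 1 - \<epsilon>"
proof -
  have n: "nm s > 0" using assms by (smt (verit) divide_pos_pos)
  have "1 < \<epsilon> * (1 + nm s)" using assms by (simp add: field_simps)
  then have "(1 - \<epsilon>) * (1 + nm s) < nm s" by (simp add: algebra_simps)
  then have "1 - \<epsilon> < nm s / (1 + nm s)" using n by (simp add: pos_less_divide_eq)
  then show ?thesis using assms by (simp add: radial_def)
qed

section \<open>Asymptotic disjointness and Urysohn functions\<close>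

definition asdisj :: "'a set \<Rightarrow> 'a set \<Rightarrow> bool" where
  "asdisj A B \<longleftrightarrow> (\<forall>r. \<exists>R. \<forall>a\<in>A. \<forall>b\<in>B. d a b \<le> r \<longrightarrow> nm a \<le> R)"

text \<open>Points at distance at most \<open>r\<close> have norms differing by at most
  \<open>r\<close>, so the one-sided bound in the definition bounds both points.\<close>

lemma asdisj_sym:
  assumes "A \<subseteq> X" "B \<subseteq> X" "asdisj A B"
  shows "asdisj B A"
  unfolding asdisj_def
proof
  fix r
  obtain R where R: "\<And>a b. \<lbrakk>a \<in> A; b \<in> B; d a b \<le> r\<rbrakk> \<Longrightarrow> nm a \<le> R"
    using assms(3) unfolding asdisj_def by meson
  have "nm b \<le> r + R" if "b \<in> B" "a \<in> A" "d b a \<le> r" for a b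
    using R[of a b] nm_triangle[of b a] that assms commute[of a b] by (smt (verit) subsetD)
  then show "\<exists>R. \<forall>b\<in>B. \<forall>a\<in>A. d b a \<le> r \<longrightarrow> nm b \<le> R" by blast
qed

lemma asdisj_mono: "\<lbrakk>asdisj A B; A' \<subseteq> A; B' \<subseteq> B\<rbrakk> \<Longrightarrow> asdisj A' B'"
  unfolding asdisj_def by (meson subsetD)

lemma asdisj_Un: 
  assumes "asdisj A B" "asdisj A C" shows "asdisj A (B \<union> C)"
  unfolding asdisj_def
proof
  fix r
  obtain R R' where "\<forall>a\<in>A. \<forall>b\<in>B. d a b \<le> r \<longrightarrow> nm a \<le> R" "\<forall>a\<in>A. \<forall>b\<in>C. d a b \<le> r \<longrightarrow> nm a \<le> R'"
    using assms unfolding asdisj_def by meson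
  then show "\<exists>R. \<forall>a\<in>A. \<forall>b\<in>B\<union>C. d a b \<le> r \<longrightarrow> nm a \<le> R"
    by (intro exI[of _ "max R R'"]) fastforce
qed

text \<open>Replaces a set by one within bounded distance of it; the displacement \<open>k\<close>
  is absorbed by using the bound at scale \<open>r + k\<close>.\<close>

lemma asdisj_near:
  assumes "asdisj A B" "A \<subseteq> X" "B \<subseteq> X" "B' \<subseteq> X" "\<And>b. b \<in> B' \<Longrightarrow> \<exists>c\<in>B. d b c \<le> k"
  shows "asdisj A B'"
  unfolding asdisj_def
proof
  fix r
  obtain R where R: "\<And>a b. \<lbrakk>a \<in> A; b \<in> B; d a b \<le> r + k\<rbrakk> \<Longrightarrow> nm a \<le> R"
    using assms(1) unfolding asdisj_def by meson
  have "nm a \<le> R" if "a \<in> A" "b \<in> B'" "d a b \<le> r" for a b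
  proof -
    obtain c where "c \<in> B" "d b c \<le> k" using assms(5)[OF \<open>b \<in> B'\<close>] by blast
    moreover have "d a c \<le> d a b + d b c" using triangle that assms \<open>c \<in> B\<close> by blast
    ultimately show ?thesis using R[of a c] that by simp
  qed
  then show "\<exists>R. \<forall>a\<in>A. \<forall>b\<in>B'. d a b \<le> r \<longrightarrow> nm a \<le> R" by blast
qed

definition dist_to_set :: "'a set \<Rightarrow> 'a \<Rightarrow> real" where
  "dist_to_set A s = (INF a\<in>A. d s a)"

lemma dist_to_set_le: "a \<in> A \<Longrightarrow> dist_to_set A s \<le> d s a"
  unfolding dist_to_set_def by (intro cINF_lower bdd_belowI2[of _ 0]) auto

lemma dist_to_set_nonneg: "A \<noteq> {} \<Longrightarrow> dist_to_set A s \<ge> 0"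
  unfolding dist_to_set_def by (intro cINF_greatest) auto

lemma dist_to_set_less: 
  assumes "A \<noteq> {}" "dist_to_set A s < r" obtains a where "a \<in> A" "d s a < r"
  using assms unfolding dist_to_set_def by (subst (asm) cINF_less_iff) (auto intro!: bdd_belowI2[of _ 0])

lemma dist_to_set_Lipschitz:
  assumes "A \<noteq> {}" "A \<subseteq> X" "s \<in> X" "t \<in> X"
  shows "\<bar>dist_to_set A s - dist_to_set A t\<bar> \<le> d s t"
proof -
  have "dist_to_set A s \<le> d s t + dist_to_set A t" if "s \<in> X" "t \<in> X" for s t
  proof -
    have "dist_to_set A s - d s t \<le> d t a" if "a \<in> A" for a
      using dist_to_set_le[OF that, of s] triangle[of s t a] that assms \<open>s \<in> X\<close> \<open>t \<in> X\<close> by (smt (verit) subsetD)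
    then have "dist_to_set A s - d s t \<le> dist_to_set A t"
      unfolding dist_to_set_def[of A t] using assms by (intro cINF_greatest) auto
    then show ?thesis by simp
  qed
  from this[of s t] this[of t s] show ?thesis using assms commute by (auto simp: abs_le_iff)
qed

text \<open>The usual quotient of distances works because asymptotic disjointness is what makes the
  sum of the two distances tend to infinity. The 1 in the denominator costs the exact value 1 on
  \<open>B\<close>; it is reached only in the limit, which is enough on the corona.\<close>

lemma asdisj_Urysohn:
  assumes S: "S \<subseteq> X" and A: "A \<subseteq> X" and B: "B \<subseteq> X" and ad: "asdisj A B"
  obtains \<phi> where "\<phi> \<in> CH S" "\<And>s. \<lbrakk>s \<in> S; s \<in> A\<rbrakk> \<Longrightarrow> \<phi> s = 0"
    "\<And>\<epsilon>. \<epsilon> > 0 \<Longrightarrow> \<exists>R. \<forall>s\<in>S. s \<in> B \<longrightarrow> nm s \<ge> R \<longrightarrow> \<phi> s > 1 - \<epsilon>"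
proof -
  \<comment> \<open>Adding the base point makes both distances meaningful and keeps the sets asymptotically disjoint.\<close>
  define A1 where "A1 = insert x0 A"
  define B1 where "B1 = insert x0 B"
  have sub: "A1 \<subseteq> X" "B1 \<subseteq> X" "A1 \<noteq> {}" "B1 \<noteq> {}" using A B base_in by (auto simp: A1_def B1_def)
  have bound: "\<exists>R. \<forall>a\<in>A1. \<forall>b\<in>B1. d a b \<le> r \<longrightarrow> nm a \<le> R" for r
  proof -
    obtain R where R: "\<forall>a\<in>A. \<forall>b\<in>B. d a b \<le> r \<longrightarrow> nm a \<le> R" using ad unfolding asdisj_def by blast
    have "nm x0 = 0" using base_in by simp
    then have "\<forall>a\<in>A1. \<forall>b\<in>B1. d a b \<le> r \<longrightarrow> nm a \<le> max 0 (max r R)"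
      using R by (auto simp: A1_def B1_def)
    then show ?thesis by blast
  qed
  define f where "f = dist_to_set A1"
  define g where "g = dist_to_set B1"
  define \<phi> where "\<phi> = (\<lambda>s\<in>S. f s / (1 + f s + g s))"
  have pos: "f s \<ge> 0" "g s \<ge> 0" for s using dist_to_set_nonneg sub by (auto simp: f_def g_def)
  have big: "\<exists>D. \<forall>s\<in>S. nm s \<ge> D \<longrightarrow> f s + g s \<ge> L" for L
  proof -
    obtain R where R: "\<And>a b. \<lbrakk>a\<in>A1; b\<in>B1; d a b \<le> L + L\<rbrakk> \<Longrightarrow> nm a \<le> R" using bound by meson
    have "f s + g s \<ge> L" if "s \<in> S" "nm s \<ge> L + R + 1" for s
    proof (rule ccontr)
      assume "\<not> f s + g s \<ge> L"
      then have "f s < L" "g s < L" using pos[of s] by auto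
      then obtain a b where ab: "a \<in> A1" "d s a < L" "b \<in> B1" "d s b < L"
        using dist_to_set_less sub unfolding f_def g_def by metis
      have X: "s \<in> X" "a \<in> X" "b \<in> X" using ab sub S that by auto
      have "d a b \<le> L + L" using triangle[of a s b] X ab commute[of a s] by simp
      then have "nm a \<le> R" using R ab by blast
      then show False using nm_triangle[of s a] X ab that by simp
    qed
    then show ?thesis by blast
  qed
  have "\<phi> \<in> CH S" unfolding \<phi>_def
    by (rule Ch_ratio[OF S]) (use pos big sub S dist_to_set_Lipschitz in \<open>auto simp: f_def g_def subset_iff\<close>)
  moreover have "\<phi> s = 0" if "s \<in> S" "s \<in> A" for s
  proof -
    have "f s \<le> d s s" using dist_to_set_le[of s A1 s] that by (simp add: f_def A1_def)
    then have "f s = 0" using pos[of s] that S by (simp add: subset_iff)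
    then show ?thesis by (simp add: \<phi>_def that)
  qed
  moreover have "\<exists>R. \<forall>s\<in>S. s \<in> B \<longrightarrow> nm s \<ge> R \<longrightarrow> \<phi> s > 1 - \<epsilon>" if "\<epsilon> > 0" for \<epsilon>
  proof -
    obtain D where D: "\<forall>s\<in>S. nm s \<ge> D \<longrightarrow> f s + g s \<ge> 1/\<epsilon>" using big by blast
    have "\<phi> s > 1 - \<epsilon>" if s: "s \<in> S" "s \<in> B" "nm s \<ge> D" for s
    proof -
      have "g s \<le> d s s" using dist_to_set_le[of s B1 s] s by (simp add: g_def B1_def)
      then have g0: "g s = 0" using pos[of s] s S by (simp add: subset_iff)
      then have "1/\<epsilon> \<le> f s" using D s by force
      then have "1 < \<epsilon> * (1 + f s)" using \<open>\<epsilon> > 0\<close> by (simp add: field_simps)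
      then have "(1 - \<epsilon>) * (1 + f s) < f s" by (simp add: algebra_simps)
      then have "1 - \<epsilon> < f s / (1 + f s)" using pos[of s] by (simp add: pos_less_divide_eq add_pos_nonneg)
      then show ?thesis by (simp add: \<phi>_def s g0)
    qed
    then show ?thesis by blast
  qed
  ultimately show thesis using that by blast
qed

section \<open>Points at infinity and close maps\<close>

text \<open>Evaluating a point of the compactification at a Higson function is taking a limit along
  this filter, so the algebra of such evaluations reduces to limit theorems.\<close>
definition point_filter :: "'a set \<Rightarrow> (('a \<Rightarrow> real) \<Rightarrow> real) \<Rightarrow> 'a filter" where
  "point_filter S y = inf (principal S) (filtercomap (emb S) (nhdsin (cube S) y))"

lemma topspace_cube: "topspace (cube S) = CH S \<rightarrow>\<^sub>E {0..1}"
  by (simp add: higson_cube_def)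

lemma compact_cube: "compact_space (cube S)"
  unfolding higson_cube_def compact_space_product_topology
  by (simp add: compact_space_subtopology)

lemma Hausdorff_cube: "Hausdorff_space (cube S)"
  unfolding higson_cube_def Hausdorff_space_product_topology
  by (simp add: Hausdorff_space_subtopology)

lemma emb_in_cube: "s \<in> S \<Longrightarrow> emb S s \<in> topspace (cube S)"
  unfolding topspace_cube higson_emb_def using ChD_range by fastforce

lemma cpt_subset_cube: "cpt S \<subseteq> topspace (cube S)"
  unfolding higson_compact_def by (rule closure_of_subset_topspace)

lemma emb_in_cpt: "s \<in> S \<Longrightarrow> emb S s \<in> cpt S"
  unfolding higson_compact_def using closure_of_subset[of "emb S ` S" "cube S"] emb_in_cube by blast

lemma eventually_point_filter:
  assumes "y \<in> topspace (cube S)"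
  shows "eventually P (point_filter S y) \<longleftrightarrow> (\<exists>U. openin (cube S) U \<and> y \<in> U \<and> (\<forall>s\<in>S. emb S s \<in> U \<longrightarrow> P s))"
proof
  assume "eventually P (point_filter S y)"
  then obtain Q where Q: "eventually Q (nhdsin (cube S) y)" "\<And>s. Q (emb S s) \<Longrightarrow> s \<in> S \<Longrightarrow> P s"
    unfolding point_filter_def inf.commute[of "principal S"] eventually_inf_principal eventually_filtercomap by blast
  then obtain U where "openin (cube S) U" "y \<in> U" "\<forall>x\<in>U. Q x"
    using assms unfolding eventually_nhdsin by blast
  then show "\<exists>U. openin (cube S) U \<and> y \<in> U \<and> (\<forall>s\<in>S. emb S s \<in> U \<longrightarrow> P s)" using Q by blast
next
  assume "\<exists>U. openin (cube S) U \<and> y \<in> U \<and> (\<forall>s\<in>S. emb S s \<in> U \<longrightarrow> P s)"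
  then obtain U where U: "openin (cube S) U" "y \<in> U" "\<forall>s\<in>S. emb S s \<in> U \<longrightarrow> P s" by blast
  have "eventually (\<lambda>x. x \<in> U) (nhdsin (cube S) y)" unfolding eventually_nhdsin using U by blast
  then show "eventually P (point_filter S y)"
    unfolding point_filter_def inf.commute[of "principal S"] eventually_inf_principal eventually_filtercomap
    using U by blast
qed

lemma eventually_point_filter_in: "eventually (\<lambda>s. s \<in> S) (point_filter S y)"
  unfolding point_filter_def by (simp add: eventually_inf_principal inf.commute[of "principal S"])

lemma in_closure_emb_iff:
  assumes "y \<in> topspace (cube S)" "E \<subseteq> S"
  shows "y \<in> cube S closure_of (emb S ` E) \<longleftrightarrow> frequently (\<lambda>s. s \<in> E) (point_filter S y)"
  unfolding frequently_def eventually_point_filter[OF assms(1)] in_closure_of using assms by blast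

lemma point_filter_nonbot: "y \<in> cpt S \<Longrightarrow> point_filter S y \<noteq> bot"
proof -
  assume y: "y \<in> cpt S"
  then have "frequently (\<lambda>s. s \<in> S) (point_filter S y)"
    using in_closure_emb_iff[of y S S] cpt_subset_cube by (auto simp: higson_compact_def)
  then show ?thesis by (metis eventually_bot frequently_def)
qed

lemma openin_cube_coordinate:
  assumes "\<phi> \<in> CH S" "open V"
  shows "openin (cube S) {z \<in> topspace (cube S). z \<phi> \<in> V}"
proof -
  have "continuous_map (cube S) (top_of_set {0..1}) (\<lambda>z. z \<phi>)"
    unfolding higson_cube_def using assms(1) by (rule continuous_map_product_projection)
  then have "continuous_map (cube S) euclideanreal (\<lambda>z. z \<phi>)"
    by (simp add: continuous_map_in_subtopology)
  then show ?thesis using assms(2) openin_continuous_map_preimage open_openin by blast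
qed

lemma point_filter_tendsto:
  assumes "y \<in> topspace (cube S)" "\<phi> \<in> CH S"
  shows "(\<phi> \<longlongrightarrow> y \<phi>) (point_filter S y)"
proof (rule topological_tendstoI)
  fix V assume V: "open V" "y \<phi> \<in> V"
  show "eventually (\<lambda>s. \<phi> s \<in> V) (point_filter S y)"
    unfolding eventually_point_filter[OF assms(1)]
    by (rule exI[of _ "{z \<in> topspace (cube S). z \<phi> \<in> V}"])
       (use V assms openin_cube_coordinate in \<open>auto simp: higson_emb_def\<close>)
qed

lemma point_filter_basis:
  assumes "y \<in> topspace (cube S)" "eventually P (point_filter S y)"
  obtains F \<epsilon> where "finite F" "F \<subseteq> CH S" "\<epsilon> > 0"
    "\<And>s. \<lbrakk>s \<in> S; \<forall>\<phi>\<in>F. \<bar>\<phi> s - y \<phi>\<bar> < \<epsilon>\<rbrakk> \<Longrightarrow> P s"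
proof -
  obtain U where U: "openin (cube S) U" "y \<in> U" "\<forall>s\<in>S. emb S s \<in> U \<longrightarrow> P s"
    using assms(2) unfolding eventually_point_filter[OF assms(1)] by blast
  obtain F \<epsilon> where F: "finite F" "F \<subseteq> CH S" "\<epsilon> > 0"
    "\<And>z. \<lbrakk>z \<in> CH S \<rightarrow>\<^sub>E {0..1}; \<forall>\<phi>\<in>F. \<bar>z \<phi> - y \<phi>\<bar> < \<epsilon>\<rbrakk> \<Longrightarrow> z \<in> U"
    by (rule openin_product_interval_basis[OF U(1)[unfolded higson_cube_def] U(2)]) (rule that)
  show thesis
  proof (rule that[OF F(1-3)])
    fix s assume s: "s \<in> S" "\<forall>\<phi>\<in>F. \<bar>\<phi> s - y \<phi>\<bar> < \<epsilon>"
    have "emb S s \<in> U"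
      using F(4)[of "emb S s"] emb_in_cube[OF s(1)] s(2) F(2) unfolding topspace_cube
      by (auto simp: higson_emb_def subset_iff)
    then show "P s" using U s by blast
  qed
qed

text \<open>Since \<open>emb\<close> maps into \<open>cpt S\<close>, closure there is closure in the
  cube cut down to \<open>cpt S\<close>, and adherence becomes being met frequently along the
  filter.\<close>

lemma corona_trace_iff:
  assumes "C \<subseteq> S"
  shows "y \<in> tr S C \<longleftrightarrow> y \<in> cor S \<and> frequently (\<lambda>s. s \<in> C) (point_filter S y)"
proof -
  have "cpt S \<inter> emb S ` C = emb S ` C" using emb_in_cpt assms by blast
  moreover have "y \<in> cpt S \<Longrightarrow> y \<in> cube S closure_of (emb S ` C) \<longleftrightarrow> frequently (\<lambda>s. s \<in> C) (point_filter S y)"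
    using in_closure_emb_iff[OF _ assms, of y] cpt_subset_cube by blast
  ultimately show ?thesis
    unfolding corona_trace_def closure_of_subtopology higson_corona_def by auto
qed

text \<open>If bounded parts of S are not compact (separators are arbitrary subsets), the corona of S
  as defined also contains points lying over bounded parts; these are excluded here.\<close>
definition at_infinity :: "'a set \<Rightarrow> (('a \<Rightarrow> real) \<Rightarrow> real) \<Rightarrow> bool" where
  "at_infinity S y \<longleftrightarrow> y \<in> cpt S \<and> y (radial S) = 1"

lemma at_infinity_in_cube: "at_infinity S y \<Longrightarrow> y \<in> topspace (cube S)"
  using cpt_subset_cube at_infinity_def by blast

lemma at_infinity_nonbot: "at_infinity S y \<Longrightarrow> point_filter S y \<noteq> bot"
  using point_filter_nonbot at_infinity_def by blast

lemma at_infinity_corona: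
  assumes "S \<subseteq> X" "at_infinity S y" shows "y \<in> cor S"
proof -
  have "y \<noteq> emb S s" if "s \<in> S" for s
    using assms radial_less_1[OF that] radial_in_Ch[OF assms(1)] by (auto simp: at_infinity_def higson_emb_def)
  then show ?thesis using assms by (auto simp: higson_corona_def at_infinity_def)
qed

lemma at_infinity_far:
  assumes "S \<subseteq> X" "at_infinity S y" shows "eventually (\<lambda>s. s \<in> S \<and> nm s > R) (point_filter S y)"
proof -
  define R' where "R' = max R 0"
  have "(radial S \<longlongrightarrow> y (radial S)) (point_filter S y)"
    using point_filter_tendsto at_infinity_in_cube assms radial_in_Ch by blast
  moreover have "R' / (1 + R') < y (radial S)" using assms by (simp add: at_infinity_def R'_def divide_less_eq)
  ultimately have "eventually (\<lambda>s. R' / (1 + R') < radial S s) (point_filter S y)"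
    by (rule order_tendstoD(1))
  then show ?thesis using eventually_point_filter_in[of S y]
    by eventually_elim (use radial_greater[of _ S R'] in \<open>auto simp: R'_def\<close>)
qed

definition boundedly_compact :: "'a set \<Rightarrow> bool" where
  "boundedly_compact S \<longleftrightarrow> S \<subseteq> X \<and> (\<forall>R. compactin (Metric_space.mtopology S d) {s\<in>S. nm s \<le> R})"

text \<open>A radial value below 1 confines the filter of \<open>y\<close> to a bounded piece of
  \<open>S\<close>. Its image is compact, hence closed in the Hausdorff cube, so \<open>y\<close>
  would be the image of a point of \<open>S\<close>.\<close>

lemma boundedly_compact_corona_at_infinity:
  assumes "boundedly_compact S" "y \<in> cor S" shows "at_infinity S y"
proof (rule ccontr)
  assume no: "\<not> at_infinity S y"
  have SX: "S \<subseteq> X" using assms boundedly_compact_def by blast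
  interpret S: Metric_space S d using sub_Metric SX by blast
  have y: "y \<in> cpt S" "y \<notin> emb S ` S" "y \<in> topspace (cube S)"
    using assms(2) cpt_subset_cube by (auto simp: higson_corona_def)
  have "y (radial S) \<in> {0..1}" using y(3) radial_in_Ch[OF SX] unfolding topspace_cube by blast
  then have "y (radial S) < 1" using no y by (auto simp: at_infinity_def)
  define \<epsilon> where "\<epsilon> = (1 - y (radial S))/2"
  have \<epsilon>: "\<epsilon> > 0" "y (radial S) < 1 - \<epsilon>" using \<open>y (radial S) < 1\<close> by (auto simp: \<epsilon>_def field_simps)
  define K where "K = {s\<in>S. nm s \<le> 1/\<epsilon>}"
  have "eventually (\<lambda>s. radial S s < 1 - \<epsilon>) (point_filter S y)"
    using order_tendstoD(2)[OF point_filter_tendsto[OF y(3) radial_in_Ch[OF SX]] \<epsilon>(2)] .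
  then have "eventually (\<lambda>s. s \<in> K) (point_filter S y)" using eventually_point_filter_in[of S y]
    by eventually_elim (use radial_tends[OF \<epsilon>(1), of _ S] in \<open>force simp: K_def\<close>)
  then have "frequently (\<lambda>s. s \<in> K) (point_filter S y)"
    using point_filter_nonbot[OF y(1)] eventually_frequently by blast
  then have cl: "y \<in> cube S closure_of (emb S ` K)"
    using in_closure_emb_iff[OF y(3), of K] by (auto simp: K_def)
  have "continuous_map S.mtopology (cube S) (emb S)"
    unfolding higson_cube_def continuous_map_componentwise continuous_map_in_subtopology
    using ChD_range by (auto simp: higson_emb_def Ch_def)
  then have "compactin (cube S) (emb S ` K)"
    using assms(1) unfolding boundedly_compact_def K_def by (blast intro: image_compactin)
  then have "closedin (cube S) (emb S ` K)" using compactin_imp_closedin Hausdorff_cube by blast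
  then have "y \<in> emb S ` K" using cl closure_of_closedin by blast
  then show False using y(2) by (auto simp: K_def)
qed

section \<open>Nets: discrete sets with finite bounded parts\<close>

definition net :: "'a set \<Rightarrow> bool" where
  "net N \<longleftrightarrow> N \<subseteq> X \<and> (\<forall>s\<in>N. \<forall>t\<in>N. s \<noteq> t \<longrightarrow> d s t \<ge> 1) \<and> (\<forall>R. finite {s\<in>N. nm s \<le> R})"

text \<open>Heredity without any closedness condition is the reason for working with nets: every
  separator inside a net is again a net.\<close>

lemma net_subset:
  assumes "net N" "M \<subseteq> N" shows "net M"
proof -
  have "finite {s\<in>M. nm s \<le> R}" for R
    by (rule finite_subset[of _ "{s\<in>N. nm s \<le> R}"]) (use assms in \<open>auto simp: net_def\<close>)
  moreover have "\<forall>s\<in>M. \<forall>t\<in>M. s \<noteq> t \<longrightarrow> d s t \<ge> 1" "M \<subseteq> X" using assms unfolding net_def by blast+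
  ultimately show ?thesis by (simp add: net_def)
qed

lemma net_sub: "net N \<Longrightarrow> N \<subseteq> X"
  by (simp add: net_def)

lemma net_boundedly_compact: "net N \<Longrightarrow> boundedly_compact N"
proof -
  assume N: "net N"
  interpret N: Metric_space N d using sub_Metric net_sub N by blast
  show ?thesis using N unfolding boundedly_compact_def net_def
    by (auto intro!: finite_imp_compactin)
qed

lemma net_cor_iff: "net N \<Longrightarrow> y \<in> cor N \<longleftrightarrow> at_infinity N y"
  using net_boundedly_compact boundedly_compact_corona_at_infinity at_infinity_corona net_sub by blast

lemma Ch_net:
  assumes N: "net N" and "\<phi> \<in> N \<rightarrow>\<^sub>E {0..1}"
    and "\<And>r \<epsilon>. \<lbrakk>r > 0; \<epsilon> > 0\<rbrakk> \<Longrightarrow> \<exists>D. \<forall>s\<in>N. \<forall>t\<in>N. nm s \<ge> D \<longrightarrow> d s t < r \<longrightarrow> \<bar>\<phi> s - \<phi> t\<bar> < \<epsilon>"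
  shows "\<phi> \<in> CH N"
proof (rule ChI)
  fix a \<epsilon> assume "a \<in> N" "(\<epsilon>::real) > 0"
  then have "\<forall>t\<in>N. d a t < 1 \<longrightarrow> \<bar>\<phi> a - \<phi> t\<bar> < \<epsilon>" using N unfolding net_def by force
  then show "\<exists>\<delta>>0. \<forall>t\<in>N. d a t < \<delta> \<longrightarrow> \<bar>\<phi> a - \<phi> t\<bar> < \<epsilon>" using zero_less_one by blast
qed (use assms net_sub in auto)

section \<open>Close maps and the maps they induce on coronas\<close>

definition close_map :: "'a set \<Rightarrow> 'a set \<Rightarrow> ('a \<Rightarrow> 'a) \<Rightarrow> real \<Rightarrow> bool" where
  "close_map N S p k \<longleftrightarrow> N \<subseteq> X \<and> S \<subseteq> X \<and> p \<in> N \<rightarrow> S \<and> (\<forall>u\<in>N. d u (p u) \<le> k) \<and>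
     (\<forall>\<phi>\<in>CH S. (\<lambda>u\<in>N. \<phi> (p u)) \<in> CH N)"

lemma close_map_id: "S \<subseteq> X \<Longrightarrow> close_map S S id 0"
  unfolding close_map_def by (auto simp: ChD_restrict subset_iff)

text \<open>The selection \<open>p\<close> may be discontinuous in general; discreteness of
  \<open>N\<close> removes the continuity question, and slow oscillation survives because
  \<open>p\<close> moves points by at most \<open>k\<close>. This is why preservation of Higson
  functions is a clause of \<open>close_map\<close>.\<close>

lemma close_map_net:
  assumes N: "net N" and S: "S \<subseteq> X" and p: "p \<in> N \<rightarrow> S" and k: "\<And>u. u \<in> N \<Longrightarrow> d u (p u) \<le> k"
  shows "close_map N S p k"
proof -
  have "(\<lambda>u\<in>N. \<phi> (p u)) \<in> CH N" if \<phi>: "\<phi> \<in> CH S" for \<phi>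
  proof (rule Ch_net[OF N])
    show "(\<lambda>u\<in>N. \<phi> (p u)) \<in> N \<rightarrow>\<^sub>E {0..1}" using ChD_range[OF \<phi>] p by fastforce
  next
    fix r \<epsilon> :: real assume "r > 0" "\<epsilon> > 0"
    obtain D where D: "\<And>s t. \<lbrakk>s \<in> S; t \<in> S; nm s \<ge> D; d s t \<le> k + r + k\<rbrakk> \<Longrightarrow> \<bar>\<phi> s - \<phi> t\<bar> < \<epsilon>"
      using ChD_osc[OF S \<phi> \<open>\<epsilon> > 0\<close>] by metis
    have "\<bar>\<phi> (p s) - \<phi> (p t)\<bar> < \<epsilon>" if st: "s \<in> N" "t \<in> N" "nm s \<ge> D + k" "d s t < r" for s t
    proof (rule D)
      have X: "s \<in> X" "t \<in> X" "p s \<in> X" "p t \<in> X" using st p S net_sub[OF N] by auto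
      show "nm (p s) \<ge> D" using nm_triangle[of s "p s"] X k[of s] st by simp
      show "d (p s) (p t) \<le> k + r + k"
        using triangle[of "p s" s "p t"] triangle[of s t "p t"] X k[of s] k[of t] st commute[of s "p s"]
        by simp
    qed (use st p in auto)
    then show "\<exists>D. \<forall>s\<in>N. \<forall>t\<in>N. nm s \<ge> D \<longrightarrow> d s t < r \<longrightarrow> \<bar>(\<lambda>u\<in>N. \<phi> (p u)) s - (\<lambda>u\<in>N. \<phi> (p u)) t\<bar> < \<epsilon>"
      by (intro exI[of _ "D + k"]) auto
  qed
  then show ?thesis using assms net_sub by (auto simp: close_map_def)
qed

text \<open>The transpose of composition with \<open>p\<close>, and so the extension of
  \<open>p\<close> to the compactifications. It is defined on the whole cube, where continuity is
  checked coordinatewise.\<close>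

definition corona_map :: "'a set \<Rightarrow> 'a set \<Rightarrow> ('a \<Rightarrow> 'a) \<Rightarrow> (('a \<Rightarrow> real) \<Rightarrow> real) \<Rightarrow> (('a \<Rightarrow> real) \<Rightarrow> real)" where
  "corona_map N S p y = (\<lambda>\<phi>\<in>CH S. y (\<lambda>u\<in>N. \<phi> (p u)))"

lemma corona_map_continuous:
  assumes "close_map N S p k"
  shows "continuous_map (cube N) (cube S) (corona_map N S p)"
proof -
  have "continuous_map (cube N) (top_of_set {0..1}) (\<lambda>y. corona_map N S p y \<phi>)" if "\<phi> \<in> CH S" for \<phi>
    using continuous_map_product_projection[of "\<lambda>u\<in>N. \<phi> (p u)" "CH N" "\<lambda>_. top_of_set {0..1}"] that assms
    unfolding higson_cube_def corona_map_def close_map_def by simp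
  then show ?thesis
    unfolding higson_cube_def[of S] continuous_map_componentwise
    by (auto simp: corona_map_def)
qed

lemma corona_map_in_cube: "close_map N S p k \<Longrightarrow> y \<in> topspace (cube N) \<Longrightarrow> corona_map N S p y \<in> topspace (cube S)"
  using corona_map_continuous continuous_map_image_subset_topspace by blast

lemma corona_map_id: "S \<subseteq> X \<Longrightarrow> y \<in> topspace (cube S) \<Longrightarrow> corona_map S S id y = y"
  unfolding topspace_cube corona_map_def by (auto simp: ChD_restrict PiE_def extensional_def)

text \<open>The image under \<open>p\<close> of the filter of \<open>y\<close> is finer than the
  filter of \<open>corona_map N S p y\<close>: a basic neighbourhood tests finitely many Higson
  functions, and their composites with \<open>p\<close> converge along the filter of
  \<open>y\<close>.\<close>

lemma corona_map_eventually:
  assumes cm: "close_map N S p k" and y: "y \<in> topspace (cube N)"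
    and ev: "eventually P (point_filter S (corona_map N S p y))"
  shows "eventually (\<lambda>u. P (p u)) (point_filter N y)"
proof -
  obtain F \<epsilon> where F: "finite F" "F \<subseteq> CH S" "\<epsilon> > 0"
    "\<And>s. \<lbrakk>s \<in> S; \<forall>\<phi>\<in>F. \<bar>\<phi> s - corona_map N S p y \<phi>\<bar> < \<epsilon>\<rbrakk> \<Longrightarrow> P s"
    using point_filter_basis[OF corona_map_in_cube[OF cm y] ev] by metis
  have "eventually (\<lambda>u. \<bar>\<phi> (p u) - corona_map N S p y \<phi>\<bar> < \<epsilon>) (point_filter N y)" if "\<phi> \<in> F" for \<phi>
  proof -
    have "(\<lambda>u\<in>N. \<phi> (p u)) \<in> CH N" using that F cm by (auto simp: close_map_def)
    then have "eventually (\<lambda>u. dist ((\<lambda>u\<in>N. \<phi> (p u)) u) (y (\<lambda>u\<in>N. \<phi> (p u))) < \<epsilon>) (point_filter N y)"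
      using point_filter_tendsto[OF y] F(3) tendstoD by blast
    then show ?thesis using eventually_point_filter_in[of N y]
      by eventually_elim (use that F in \<open>auto simp: corona_map_def dist_real_def\<close>)
  qed
  then have "eventually (\<lambda>u. \<forall>\<phi>\<in>F. \<bar>\<phi> (p u) - corona_map N S p y \<phi>\<bar> < \<epsilon>) (point_filter N y)"
    using F(1) by (simp add: eventually_ball_finite)
  then show ?thesis using eventually_point_filter_in[of N y]
  proof eventually_elim
    case (elim u)
    then have "p u \<in> S" using cm by (auto simp: close_map_def)
    then show ?case using F(4) elim by blast
  qed
qed

lemma corona_map_at_infinity:
  assumes cm: "close_map N S p k" and y: "at_infinity N y"
  shows "at_infinity S (corona_map N S p y)"
proof -
  have X: "N \<subseteq> X" "S \<subseteq> X" using cm by (auto simp: close_map_def)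
  have yc: "y \<in> topspace (cube N)" using y at_infinity_in_cube by blast
  note jc = corona_map_in_cube[OF cm yc]
  have "\<not> eventually (\<lambda>s. s \<notin> S) (point_filter S (corona_map N S p y))"
  proof
    assume "eventually (\<lambda>s. s \<notin> S) (point_filter S (corona_map N S p y))"
    then have "eventually (\<lambda>u. p u \<notin> S) (point_filter N y)" by (rule corona_map_eventually[OF cm yc])
    then have "eventually (\<lambda>u. False) (point_filter N y)" using eventually_point_filter_in[of N y]
      by eventually_elim (use cm in \<open>auto simp: close_map_def\<close>)
    then show False using at_infinity_nonbot[OF y] by (simp add: trivial_limit_def)
  qed
  then have 1: "corona_map N S p y \<in> cpt S"
    using in_closure_emb_iff[OF jc, of S] by (simp add: higson_compact_def frequently_def)
  have r: "radial S \<in> CH S" "(\<lambda>u\<in>N. radial S (p u)) \<in> CH N"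
    using radial_in_Ch X cm by (auto simp: close_map_def)
  have "corona_map N S p y (radial S) \<ge> 1 - \<epsilon>" if "\<epsilon> > 0" for \<epsilon>
  proof -
    have "((\<lambda>u\<in>N. radial S (p u)) \<longlongrightarrow> corona_map N S p y (radial S)) (point_filter N y)"
      using point_filter_tendsto[OF yc r(2)] r(1) by (simp add: corona_map_def)
    moreover have "eventually (\<lambda>u. 1 - \<epsilon> \<le> (\<lambda>u\<in>N. radial S (p u)) u) (point_filter N y)"
      using at_infinity_far[OF X(1) y, of "1/\<epsilon> + k"]
    proof eventually_elim
      case (elim u)
      have "d u (p u) \<le> k" "p u \<in> S" "p u \<in> X" "u \<in> X" using elim cm X by (auto simp: close_map_def)
      then have "nm (p u) \<ge> 1/\<epsilon>" using nm_triangle[of u "p u"] elim by simp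
      then show ?case using radial_tends[OF that \<open>p u \<in> S\<close>] elim by simp
    qed
    ultimately show ?thesis by (rule tendsto_lowerbound) (use at_infinity_nonbot[OF y] in simp)
  qed
  then have "corona_map N S p y (radial S) \<ge> 1" by (meson field_le_epsilon le_diff_eq diff_le_eq)
  moreover have "corona_map N S p y (radial S) \<le> 1" using jc r(1) unfolding topspace_cube by fastforce
  ultimately show ?thesis using 1 by (simp add: at_infinity_def)
qed

text \<open>The right-hand side involves neither \<open>S\<close> nor \<open>p\<close>, only
  \<open>y\<close> and asymptotic disjointness from \<open>D\<close>. Traces in different spaces can
  therefore be compared, and sets at bounded Hausdorff distance get the same trace.\<close>

lemma corona_map_trace_iff:
  assumes cm: "close_map N S p k" and y: "at_infinity N y" and D: "D \<subseteq> S"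
  shows "corona_map N S p y \<in> tr S D \<longleftrightarrow> \<not> (\<exists>E\<subseteq>N. eventually (\<lambda>u. u \<in> E) (point_filter N y) \<and> asdisj E D)"
proof -
  have X: "N \<subseteq> X" "S \<subseteq> X" "D \<subseteq> X" using cm D by (auto simp: close_map_def)
  have yc: "y \<in> topspace (cube N)" using y at_infinity_in_cube by blast
  note jc = corona_map_in_cube[OF cm yc]
  note ji = corona_map_at_infinity[OF cm y]
  have jcor: "corona_map N S p y \<in> cor S" using at_infinity_corona X ji by blast
  have p: "\<And>u. u \<in> N \<Longrightarrow> p u \<in> S" "\<And>u. u \<in> N \<Longrightarrow> d u (p u) \<le> k" using cm by (auto simp: close_map_def)
  show ?thesis
  proof
    assume "corona_map N S p y \<in> tr S D"
    then have fr: "frequently (\<lambda>s. s \<in> D) (point_filter S (corona_map N S p y))" using corona_trace_iff[OF D] by blast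
    show "\<not> (\<exists>E\<subseteq>N. eventually (\<lambda>u. u \<in> E) (point_filter N y) \<and> asdisj E D)"
    proof
      assume "\<exists>E\<subseteq>N. eventually (\<lambda>u. u \<in> E) (point_filter N y) \<and> asdisj E D"
      then obtain E where E: "E \<subseteq> N" "eventually (\<lambda>u. u \<in> E) (point_filter N y)" "asdisj E D" by blast
      have pE: "p ` E \<subseteq> X" "E \<subseteq> X" using p(1) E X by auto
      \<comment> \<open>Functions in \<open>CH S\<close> are tested only at points of
        \<open>S\<close>, so \<open>E\<close> is first moved into \<open>S\<close> by
        \<open>p\<close>, at distance at most \<open>k\<close>.\<close>
      have "asdisj D (p ` E)"
        by (rule asdisj_near[OF asdisj_sym[OF pE(2) X(3) E(3)] X(3) pE(2) pE(1), of k])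
           (use p(2) E commute in fastforce)
      then have "asdisj (p ` E) D" using asdisj_sym pE X by blast
      then obtain \<phi> where \<phi>: "\<phi> \<in> CH S" "\<And>s. \<lbrakk>s \<in> S; s \<in> p ` E\<rbrakk> \<Longrightarrow> \<phi> s = 0"
          "\<And>\<epsilon>. \<epsilon> > 0 \<Longrightarrow> \<exists>R. \<forall>s\<in>S. s \<in> D \<longrightarrow> nm s \<ge> R \<longrightarrow> \<phi> s > 1 - \<epsilon>"
        using asdisj_Urysohn[OF X(2) pE(1) X(3)] by metis
      have "((\<lambda>u\<in>N. \<phi> (p u)) \<longlongrightarrow> corona_map N S p y \<phi>) (point_filter N y)"
        using point_filter_tendsto[OF yc, of "\<lambda>u\<in>N. \<phi> (p u)"] \<phi>(1) cm by (simp add: corona_map_def close_map_def)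
      moreover have "eventually (\<lambda>u. (\<lambda>u\<in>N. \<phi> (p u)) u = 0) (point_filter N y)"
        using E(2) by eventually_elim (use E(1) \<phi>(2) p(1) in auto)
      ultimately have "((\<lambda>u. 0) \<longlongrightarrow> corona_map N S p y \<phi>) (point_filter N y)"
        by (rule Lim_transform_eventually)
      then have 0: "corona_map N S p y \<phi> = 0"
        using at_infinity_nonbot[OF y] tendsto_unique tendsto_const by blast
      obtain R where R: "\<And>s. \<lbrakk>s \<in> S; s \<in> D; nm s \<ge> R\<rbrakk> \<Longrightarrow> \<phi> s > 1/2"
        using \<phi>(3)[of "1/2"] by auto
      have "eventually (\<lambda>s. \<phi> s < 1/2) (point_filter S (corona_map N S p y))"
        by (rule order_tendstoD(2)[OF point_filter_tendsto[OF jc \<phi>(1)]]) (simp add: 0)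
      moreover have "eventually (\<lambda>s. s \<in> S \<and> nm s > R) (point_filter S (corona_map N S p y))"
        using at_infinity_far X(2) ji by blast
      ultimately have "eventually (\<lambda>s. s \<notin> D) (point_filter S (corona_map N S p y))"
        by eventually_elim (use R in force)
      then show False using fr by (simp add: frequently_def)
    qed
  next
    assume no: "\<not> (\<exists>E\<subseteq>N. eventually (\<lambda>u. u \<in> E) (point_filter N y) \<and> asdisj E D)"
    show "corona_map N S p y \<in> tr S D"
    proof (rule ccontr)
      assume "corona_map N S p y \<notin> tr S D"
      then have "eventually (\<lambda>s. s \<notin> D) (point_filter S (corona_map N S p y))"
        using corona_trace_iff[OF D] jcor by (simp add: frequently_def)
      then obtain F \<epsilon> where F: "finite F" "F \<subseteq> CH S" "\<epsilon> > 0"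
          "\<And>s. \<lbrakk>s \<in> S; \<forall>\<phi>\<in>F. \<bar>\<phi> s - corona_map N S p y \<phi>\<bar> < \<epsilon>\<rbrakk> \<Longrightarrow> s \<notin> D"
        using point_filter_basis[OF jc] by metis
      \<comment> \<open>Half of \<epsilon> is held back for the oscillation of the functions in
        \<open>F\<close> over distance \<open>k + r\<close>: a point of \<open>D\<close> within
        \<open>r\<close> of a far point of \<open>E\<close> would fall into the
        \<epsilon>-neighbourhood, which misses \<open>D\<close>.\<close>
      define E where "E = {u\<in>N. \<forall>\<phi>\<in>F. \<bar>\<phi> (p u) - corona_map N S p y \<phi>\<bar> < \<epsilon>/2}"
      have "eventually (\<lambda>s. \<forall>\<phi>\<in>F. \<bar>\<phi> s - corona_map N S p y \<phi>\<bar> < \<epsilon>/2) (point_filter S (corona_map N S p y))"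
        unfolding eventually_ball_finite_distrib[OF F(1)]
      proof
        fix \<phi> assume "\<phi> \<in> F"
        then show "eventually (\<lambda>s. \<bar>\<phi> s - corona_map N S p y \<phi>\<bar> < \<epsilon>/2) (point_filter S (corona_map N S p y))"
          using tendstoD[OF point_filter_tendsto[OF jc], of \<phi> "\<epsilon>/2"] F by (auto simp: dist_real_def)
      qed
      from corona_map_eventually[OF cm yc this] eventually_point_filter_in[of N y]
      have evE: "eventually (\<lambda>u. u \<in> E) (point_filter N y)"
        by eventually_elim (simp add: E_def)
      have "asdisj E D"
        unfolding asdisj_def
      proof
        fix r
        have "\<exists>D. \<forall>s\<in>S. \<forall>t\<in>S. nm s \<ge> D \<longrightarrow> d s t \<le> k + r \<longrightarrow> \<bar>\<phi> s - \<phi> t\<bar> < \<epsilon>/2" if "\<phi> \<in> F" for \<phi>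
          using ChD_osc[OF X(2), of \<phi> "\<epsilon>/2" "k + r"] that F by (metis half_gt_zero subsetD)
        then obtain D0 where D0: "\<And>\<phi> s t. \<lbrakk>\<phi> \<in> F; s\<in>S; t\<in>S; nm s \<ge> D0 \<phi>; d s t \<le> k + r\<rbrakk> \<Longrightarrow> \<bar>\<phi> s - \<phi> t\<bar> < \<epsilon>/2"
          by metis
        define R where "R = Max (insert 0 (D0 ` F))"
        have R: "\<And>\<phi>. \<phi> \<in> F \<Longrightarrow> D0 \<phi> \<le> R" using F(1) by (auto simp: R_def)
        have "nm a \<le> R + k" if ab: "a \<in> E" "b \<in> D" "d a b \<le> r" for a b
        proof (rule ccontr)
          assume big: "\<not> nm a \<le> R + k"
          have aN: "a \<in> N" using ab by (simp add: E_def)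
          have XX: "a \<in> X" "p a \<in> X" "b \<in> X" "p a \<in> S" "b \<in> S" using aN ab p X D by auto
          have "nm (p a) \<ge> R" using nm_triangle[of a "p a"] XX p(2)[OF aN] big by simp
          moreover have "d (p a) b \<le> k + r"
            using triangle[of "p a" a b] XX p(2)[OF aN] ab commute[of a "p a"] by simp
          ultimately have "\<forall>\<phi>\<in>F. \<bar>\<phi> (p a) - \<phi> b\<bar> < \<epsilon>/2" using D0 R XX by (meson order_trans)
          moreover have "\<forall>\<phi>\<in>F. \<bar>\<phi> (p a) - corona_map N S p y \<phi>\<bar> < \<epsilon>/2" using ab by (simp add: E_def)
          ultimately have "\<forall>\<phi>\<in>F. \<bar>\<phi> b - corona_map N S p y \<phi>\<bar> < \<epsilon>" by (smt (verit) field_sum_of_halves)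
          then show False using F(4) XX ab by blast
        qed
        then show "\<exists>R. \<forall>a\<in>E. \<forall>b\<in>D. d a b \<le> r \<longrightarrow> nm a \<le> R" by blast
      qed
      then show False using no evE by (auto simp: E_def)
    qed
  qed
qed

lemma trace_iff_asdisj:
  assumes "S \<subseteq> X" "at_infinity S y" "D \<subseteq> S"
  shows "y \<in> tr S D \<longleftrightarrow> \<not> (\<exists>E\<subseteq>S. eventually (\<lambda>u. u \<in> E) (point_filter S y) \<and> asdisj E D)"
  using corona_map_trace_iff[OF close_map_id[OF assms(1)] assms(2,3)] corona_map_id[OF assms(1)] at_infinity_in_cube[OF assms(2)]
  by simp

text \<open>Preimages of the two open sets under the continuous map of coronas form the new
  partition; neither injectivity nor surjectivity enters. The two equivalences say that
  \<open>A\<close> matches \<open>B\<close> and \<open>C'\<close> matches \<open>C\<close> as seen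
  from subsets of \<open>N\<close>.\<close>

lemma separator_pullback:
  assumes cm: "close_map N S p k" and N: "net N"
    and sub: "A \<subseteq> N" "B \<subseteq> S" "C \<subseteq> S" "C' \<subseteq> N"
    and eqA: "\<And>E. E \<subseteq> N \<Longrightarrow> asdisj E A \<longleftrightarrow> asdisj E B"
    and eqC: "\<And>E. E \<subseteq> N \<Longrightarrow> asdisj E C' \<longleftrightarrow> asdisj E C"
    and sep: "asym_separator S d x0 (corona_map N S p x) B C" and x: "x \<in> cor N"
  shows "asym_separator N d x0 x A C'"
proof -
  let ?j = "corona_map N S p"
  have X: "N \<subseteq> X" "S \<subseteq> X" using cm by (auto simp: close_map_def)
  have jA: "?j y \<in> tr S B \<longleftrightarrow> y \<in> tr N A" if "y \<in> cor N" for y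
    using corona_map_trace_iff[OF cm _ sub(2)] trace_iff_asdisj[OF X(1) _ sub(1)] that eqA net_cor_iff[OF N] by metis
  have jC: "?j y \<in> tr S C \<longleftrightarrow> y \<in> tr N C'" if "y \<in> cor N" for y
    using corona_map_trace_iff[OF cm _ sub(3)] trace_iff_asdisj[OF X(1) _ sub(4)] that eqC net_cor_iff[OF N] by metis
  have jcor: "?j y \<in> cor S" if "y \<in> cor N" for y
    using that corona_map_at_infinity[OF cm] net_cor_iff[OF N] at_infinity_corona[OF X(2)] by blast
  have trc: "tr N A \<subseteq> cor N" "tr N C' \<subseteq> cor N" by (auto simp: corona_trace_def)
  have top: "topspace (subtopology (cube N) (cor N)) = cor N"
    using cpt_subset_cube by (auto simp: higson_corona_def)
  have cont: "continuous_map (subtopology (cube N) (cor N)) (subtopology (cube S) (cor S)) ?j"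
    using continuous_map_from_subtopology[OF corona_map_continuous[OF cm]] jcor top
    by (auto simp: continuous_map_in_subtopology)
  obtain U1 U2 where U: "openin (subtopology (cube S) (cor S)) U1" "openin (subtopology (cube S) (cor S)) U2"
      "U1 \<inter> U2 = {}" "cor S - tr S C = U1 \<union> U2" "{?j x} \<subseteq> U1" "tr S B \<subseteq> U2"
    using sep unfolding asym_separator_def is_partition_def by blast
  define V where "V U = {y \<in> cor N. ?j y \<in> U}" for U
  have op: "openin (subtopology (cube N) (cor N)) (V U1)" "openin (subtopology (cube N) (cor N)) (V U2)"
    using openin_continuous_map_preimage[OF cont] U(1,2) unfolding top V_def by auto
  have "cor N - tr N C' = V U1 \<union> V U2"
    using U(4) jC jcor by (auto simp: V_def)
  moreover have "V U1 \<inter> V U2 = {}" using U(3) by (auto simp: V_def)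
  moreover have "{x} \<subseteq> V U1" using U(5) x by (auto simp: V_def)
  moreover have "tr N A \<subseteq> V U2" using U(6) jA trc by (auto simp: V_def)
  ultimately have "is_partition (cube N) (cor N) {x} (tr N A) (tr N C')"
    unfolding is_partition_def using op trc by blast
  then show ?thesis using sub by (simp add: asym_separator_def)
qed

end

section \<open>Traces and separators on a net\<close>

text \<open>The sets \<open>C m\<close> are nested nonempty closed sets. Compactness yields a
  cluster point of the sequence, not a convergent subsequence, so later arguments use only
  arbitrarily large indices.\<close>

lemma compact_space_cluster_point:
  fixes z :: "nat \<Rightarrow> 'b"
  assumes "compact_space T" "\<And>n. z n \<in> topspace T"
  obtains x where "x \<in> topspace T" "\<And>U m. \<lbrakk>openin T U; x \<in> U\<rbrakk> \<Longrightarrow> \<exists>n\<ge>m. z n \<in> U"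
proof -
  define C where "C m = T closure_of (z ` {m..})" for m
  have "(\<Inter>m. C m) \<noteq> {}"
  proof (rule compact_space_imp_nest[OF assms(1)])
    show "closedin T (C n)" for n by (simp add: C_def)
    show "C n \<noteq> {}" for n
      using closure_of_subset[of "z ` {n..}" T] assms(2) by (auto simp: C_def)
    show "decseq C" unfolding C_def by (intro antimonoI closure_of_mono) auto
  qed
  then obtain x where x: "\<And>m. x \<in> C m" by auto
  show thesis
  proof (rule that[of x])
    show "x \<in> topspace T" using x[of 0] closure_of_subset_topspace unfolding C_def by fastforce
    show "\<exists>n\<ge>m. z n \<in> U" if "openin T U" "x \<in> U" for U m
      using x[of m] that unfolding C_def in_closure_of by auto
  qed
qed

lemma asind_le_mono: "asind_le d x0 n S \<Longrightarrow> n \<le> m \<Longrightarrow> asind_le d x0 m S"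
proof (induction arbitrary: m rule: asind_le.induct)
  case (bounded n S)
  then show ?case by (intro asind_le.bounded) auto
next
  case (sep n S)
  then have "\<And>C. (asind_le d x0 (n - 1) C \<and> (\<forall>x. n - 1 \<le> x \<longrightarrow> asind_le d x0 x C)) \<Longrightarrow> asind_le d x0 (m - 1) C"
    by simp
  then show ?case using sep by (intro asind_le.sep) (force, meson)
qed

context based_metric_space
begin

text \<open>A separator \<open>D\<close> found in the larger set is cut down to
  \<open>D \<inter> C1\<close>. The discarded part is asymptotically disjoint from
  \<open>C1\<close>, so subsets of \<open>C1\<close> see the same set at infinity, and the cut is
  asymptotically clopen in \<open>D\<close>, as the induction requires. For a general subset the cut
  could lose part of the trace.\<close>

lemma asind_le_clopen:
  assumes "asind_le d x0 n C" "net C" "C1 \<subseteq> C" "asdisj C1 (C - C1)"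
  shows "asind_le d x0 n C1"
  using assms
proof (induction arbitrary: C1 rule: asind_le.induct)
  case (bounded n S)
  then have "S \<subseteq> X" "C1 \<subseteq> X" using net_sub by auto
  then have "Metric_space.mbounded C1 d C1"
    using bounded(2,4) mbounded_iff_nm by (meson subsetD)
  then show ?case using bounded(1) by (rule asind_le.bounded[rotated])
next
  case (sep n S)
  have N: "net C1" using net_subset sep by blast
  have X: "S \<subseteq> X" "C1 \<subseteq> X" using net_sub N sep by auto
  have cm: "close_map C1 S id 0"
    by (rule close_map_net[OF N X(1)]) (use sep.prems(2) X in auto)
  show ?case
  proof (rule asind_le.sep[OF sep.hyps(1)], intro allI impI, elim conjE)
    fix x A assume x: "x \<in> cor C1" "A \<subseteq> C1" "x \<notin> tr C1 A"
    let ?x = "corona_map C1 S id x"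
    have ix: "at_infinity C1 x" using x net_cor_iff N by blast
    have AS: "A \<subseteq> S" using x sep by blast
    have "?x \<in> cor S" using corona_map_at_infinity[OF cm ix] at_infinity_corona X by blast
    moreover have "?x \<notin> tr S A"
      using x(3) unfolding corona_map_trace_iff[OF cm ix AS] trace_iff_asdisj[OF X(2) ix x(2)] .
    ultimately obtain D where D: "asym_separator S d x0 ?x A D" "asind_le d x0 (n - 1) D"
      and IH: "\<And>C1. \<lbrakk>net D; C1 \<subseteq> D; asdisj C1 (D - C1)\<rbrakk> \<Longrightarrow> asind_le d x0 (n - 1) C1"
      using sep.IH[rule_format, of ?x A] AS by auto
    have DS: "D \<subseteq> S" using D by (simp add: asym_separator_def)
    have "asind_le d x0 (n - 1) (D \<inter> C1)"
    proof (rule IH)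
      show "net D" using net_subset DS sep by blast
      show "asdisj (D \<inter> C1) (D - D \<inter> C1)" by (rule asdisj_mono[OF sep.prems(3)]) (use DS in auto)
    qed auto
    moreover have "asym_separator C1 d x0 x A (D \<inter> C1)"
    proof (rule separator_pullback[OF cm N x(2) AS DS _ _ _ D(1) x(1)])
      fix E assume E: "E \<subseteq> C1"
      show "asdisj E (D \<inter> C1) \<longleftrightarrow> asdisj E D"
      proof
        assume "asdisj E (D \<inter> C1)"
        moreover have "asdisj E (D - C1)" by (rule asdisj_mono[OF sep.prems(3) E]) (use DS in auto)
        ultimately have "asdisj E (D \<inter> C1 \<union> (D - C1))" by (rule asdisj_Un)
        then show "asdisj E D" by (simp add: Int_Diff_Un)
      qed (auto intro: asdisj_mono)
    qed auto
    ultimately show "\<exists>C. asym_separator C1 d x0 x A C \<and> asind_le d x0 (n - 1) C" by blast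
  qed
qed

text \<open>The property that makes disjoint open F-sigma subsets of the corona have disjoint closures.\<close>
lemma asdisj_diagonal:
  fixes P Q :: "nat \<Rightarrow> 'a set"
  assumes PQ: "\<And>i j. asdisj (P i) (Q j)" and X: "\<And>i. P i \<subseteq> X" "\<And>j. Q j \<subseteq> X"
  obtains R where "asdisj (\<Union>i. {s\<in>P i. nm s \<ge> R i}) (\<Union>j. {s\<in>Q j. nm s \<ge> R j})"
proof -
  have "\<exists>R. \<forall>a\<in>P i. \<forall>b\<in>Q j. d a b \<le> r \<longrightarrow> nm a \<le> R \<and> nm b \<le> R" for i j r
  proof -
    obtain R where R: "\<forall>a\<in>P i. \<forall>b\<in>Q j. d a b \<le> r \<longrightarrow> nm a \<le> R" using PQ asdisj_def by meson
    obtain R' where R': "\<forall>b\<in>Q j. \<forall>a\<in>P i. d b a \<le> r \<longrightarrow> nm b \<le> R'"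
      using asdisj_sym[OF X(1) X(2) PQ] asdisj_def by meson
    have "\<forall>a\<in>P i. \<forall>b\<in>Q j. d a b \<le> r \<longrightarrow> nm a \<le> max R R' \<and> nm b \<le> max R R'"
      using R R' by (metis commute max.coboundedI1 max.coboundedI2)
    then show ?thesis by blast
  qed
  then obtain \<rho> where \<rho>: "\<And>i j r a b. \<lbrakk>a \<in> P i; b \<in> Q j; d a b \<le> r\<rbrakk> \<Longrightarrow> nm a \<le> \<rho> i j r \<and> nm b \<le> \<rho> i j r"
    by metis
  define B where "B m r = Max ((\<lambda>(i,j). \<rho> i j r) ` ({..m} \<times> {..m}))" for m :: nat and r
  have B: "\<rho> i j r \<le> B m r" if "i \<le> m" "j \<le> m" for i j m r
    unfolding B_def by (rule Max_ge) (use that in \<open>auto intro!: image_eqI[of _ _ "(i,j)"]\<close>)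
  \<comment> \<open>At stage \<open>m\<close> the cutoff exceeds every bound for pairs of indices up
    to \<open>m\<close> at scale \<open>m\<close>.\<close>
  define R where "R m = B m (real m) + 1" for m
  have "asdisj (\<Union>i. {s\<in>P i. nm s \<ge> R i}) (\<Union>j. {s\<in>Q j. nm s \<ge> R j})"
    unfolding asdisj_def
  proof
    fix r :: real
    define M where "M = nat \<lceil>r\<rceil>"
    have "nm a \<le> B M r" if a: "a \<in> P i" "nm a \<ge> R i" and b: "b \<in> Q j" "nm b \<ge> R j" and r: "d a b \<le> r" for a b i j
    proof -
      define m where "m = max i j"
      \<comment> \<open>Whichever of \<open>a\<close>, \<open>b\<close> carries the larger index
        \<open>m\<close> has norm at least \<open>B m (real m) + 1\<close>, against the bound at
        scale \<open>m\<close>. So at scale \<open>r\<close> only finitely many index pairs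
        remain.\<close>
      have "\<not> r \<le> real m"
      proof
        assume "r \<le> real m"
        then have "nm a \<le> B m (real m)" "nm b \<le> B m (real m)"
          using \<rho>[OF a(1) b(1), of "real m"] r B[of i m j "real m"] by (auto simp: m_def)
        then show False using a b by (cases "i \<le> j") (auto simp: m_def R_def max_def)
      qed
      then have "m \<le> M" unfolding M_def by linarith
      then have "i \<le> M" "j \<le> M" by (auto simp: m_def)
      then show ?thesis using \<rho>[OF a(1) b(1) r] B[of i M j r] by linarith
    qed
    then show "\<exists>K. \<forall>a\<in>(\<Union>i. {s\<in>P i. nm s \<ge> R i}). \<forall>b\<in>(\<Union>j. {s\<in>Q j. nm s \<ge> R j}). d a b \<le> r \<longrightarrow> nm a \<le> K"
      by blast
  qed
  then show thesis using that by blast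
qed

lemma asdisj_gap:
  assumes "N \<subseteq> X" "g \<in> CH N" "a < b"
  shows "asdisj {s\<in>N. g s \<le> a} {s\<in>N. g s \<ge> b}" "asdisj {s\<in>N. g s \<ge> b} {s\<in>N. g s \<le> a}"
proof -
  show 1: "asdisj {s\<in>N. g s \<le> a} {s\<in>N. g s \<ge> b}"
    unfolding asdisj_def
  proof
    fix r
    obtain D where D: "\<And>s t. \<lbrakk>s \<in> N; t \<in> N; nm s \<ge> D; d s t \<le> r\<rbrakk> \<Longrightarrow> \<bar>g s - g t\<bar> < b - a"
      using ChD_osc[OF assms(1,2), of "b - a"] assms(3) by (metis diff_gt_0_iff_gt)
    show "\<exists>R. \<forall>s\<in>{s\<in>N. g s \<le> a}. \<forall>t\<in>{s\<in>N. g s \<ge> b}. d s t \<le> r \<longrightarrow> nm s \<le> R"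
      by (rule exI[of _ D]) (use D in force)
  qed
  show "asdisj {s\<in>N. g s \<ge> b} {s\<in>N. g s \<le> a}"
    by (rule asdisj_sym[OF _ _ 1]) (use assms in auto)
qed

section \<open>Traces read off from values of Higson functions\<close>

lemma cor_tendsto:
  assumes "y \<in> cor N" "\<phi> \<in> CH N" shows "(\<phi> \<longlongrightarrow> y \<phi>) (point_filter N y)"
proof (rule point_filter_tendsto)
  show "y \<in> topspace (cube N)" using assms cpt_subset_cube by (auto simp: higson_corona_def)
qed fact

lemma cor_nonbot: "y \<in> cor N \<Longrightarrow> point_filter N y \<noteq> bot"
  using point_filter_nonbot by (auto simp: higson_corona_def)

lemma trace_subset_cor: "tr N C \<subseteq> cor N"
  by (auto simp: corona_trace_def)

lemma trace_mono: "C \<subseteq> D \<Longrightarrow> D \<subseteq> N \<Longrightarrow> tr N C \<subseteq> tr N D"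
  using corona_trace_iff[of C N] corona_trace_iff[of D N] by (auto elim!: frequently_elim1)

lemma cor_far:
  assumes "net N" "y \<in> cor N" shows "eventually (\<lambda>s. s \<in> N \<and> nm s > R) (point_filter N y)"
  using assms at_infinity_far net_cor_iff net_sub by blast

lemma trace_le:
  assumes N: "net N" and C: "C \<subseteq> N" and y: "y \<in> tr N C" and g: "g \<in> CH N"
    and le: "\<And>s. \<lbrakk>s \<in> C; nm s > R\<rbrakk> \<Longrightarrow> g s \<le> c"
  shows "y g \<le> c"
proof (rule ccontr)
  assume "\<not> y g \<le> c"
  have y': "y \<in> cor N" "frequently (\<lambda>s. s \<in> C) (point_filter N y)" using corona_trace_iff[OF C] y by auto
  have "eventually (\<lambda>s. g s > c) (point_filter N y)"
    using order_tendstoD(1)[OF cor_tendsto[OF y'(1) g]] \<open>\<not> y g \<le> c\<close> by auto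
  with cor_far[OF N y'(1), of R] have "eventually (\<lambda>s. s \<notin> C) (point_filter N y)"
    by eventually_elim (use le in force)
  then show False using y' by (simp add: frequently_def)
qed

lemma trace_ge:
  assumes N: "net N" and C: "C \<subseteq> N" and y: "y \<in> tr N C" and g: "g \<in> CH N"
    and le: "\<And>s. \<lbrakk>s \<in> C; nm s > R\<rbrakk> \<Longrightarrow> g s \<ge> c"
  shows "y g \<ge> c"
proof (rule ccontr)
  assume "\<not> y g \<ge> c"
  have y': "y \<in> cor N" "frequently (\<lambda>s. s \<in> C) (point_filter N y)" using corona_trace_iff[OF C] y by auto
  have "eventually (\<lambda>s. g s < c) (point_filter N y)"
    using order_tendstoD(2)[OF cor_tendsto[OF y'(1) g]] \<open>\<not> y g \<ge> c\<close> by auto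
  with cor_far[OF N y'(1), of R] have "eventually (\<lambda>s. s \<notin> C) (point_filter N y)"
    by eventually_elim (use le in force)
  then show False using y' by (simp add: frequently_def)
qed

lemma trace_shell:
  assumes N: "net N" and Q: "Q \<subseteq> N" and y: "y \<in> cor N" and g: "g \<in> CH N"
    and sh: "\<And>s. \<lbrakk>s \<in> N; a < g s; g s < b; nm s > R\<rbrakk> \<Longrightarrow> s \<in> Q" and ab: "a < y g" "y g < b"
  shows "y \<in> tr N Q"
proof -
  have "eventually (\<lambda>s. s \<in> Q) (point_filter N y)"
    using order_tendstoD(1)[OF cor_tendsto[OF y g] ab(1)] order_tendstoD(2)[OF cor_tendsto[OF y g] ab(2)]
      cor_far[OF N y, of R]
    by eventually_elim (use sh in auto)
  then show ?thesis using corona_trace_iff[OF Q] y eventually_frequently[OF cor_nonbot[OF y]] by blast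
qed

lemma asdisj_trace_disjoint:
  assumes N: "net N" and "P \<subseteq> N" "Q \<subseteq> N" "asdisj P Q"
  shows "tr N P \<inter> tr N Q = {}"
proof -
  have X: "N \<subseteq> X" "P \<subseteq> X" "Q \<subseteq> X" using assms net_sub by auto
  obtain \<phi> where \<phi>: "\<phi> \<in> CH N" "\<And>s. \<lbrakk>s \<in> N; s \<in> P\<rbrakk> \<Longrightarrow> \<phi> s = 0"
      "\<And>\<epsilon>. \<epsilon> > 0 \<Longrightarrow> \<exists>R. \<forall>s\<in>N. s \<in> Q \<longrightarrow> nm s \<ge> R \<longrightarrow> \<phi> s > 1 - \<epsilon>"
    using asdisj_Urysohn[OF X assms(4)] by metis
  obtain R where R: "\<And>s. \<lbrakk>s \<in> N; s \<in> Q; nm s \<ge> R\<rbrakk> \<Longrightarrow> \<phi> s > 1/2" using \<phi>(3)[of "1/2"] by auto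
  have "y \<phi> \<le> 0" if "y \<in> tr N P" for y
    by (rule trace_le[OF N assms(2) that \<phi>(1), of 0]) (use \<phi>(2) assms in force)
  moreover have "y \<phi> \<ge> 1/2" if "y \<in> tr N Q" for y
    by (rule trace_ge[OF N assms(3) that \<phi>(1), of R]) (use R assms in force)
  ultimately show ?thesis by fastforce
qed

text \<open>A set \<open>E\<close> of the filter of \<open>x\<close> that is asymptotically disjoint
  from \<open>A\<close> gives a Urysohn function; its values exceed 1 - e far out on
  \<open>A\<close> for every e > 0, which becomes at least 1 on the trace.\<close>

lemma trace_separating_function:
  assumes N: "net N" and A: "A \<subseteq> N" and x: "x \<in> cor N" "x \<notin> tr N A"
  obtains \<phi> where "\<phi> \<in> CH N" "x \<phi> = 0" "\<And>y. y \<in> tr N A \<Longrightarrow> y \<phi> \<ge> 1"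
proof -
  have X: "N \<subseteq> X" "A \<subseteq> X" using N A net_sub by auto
  obtain E where E: "E \<subseteq> N" "eventually (\<lambda>u. u \<in> E) (point_filter N x)" "asdisj E A"
    using trace_iff_asdisj[OF X(1) _ A] x net_cor_iff[OF N] by blast
  obtain \<phi> where \<phi>: "\<phi> \<in> CH N" "\<And>s. \<lbrakk>s \<in> N; s \<in> E\<rbrakk> \<Longrightarrow> \<phi> s = 0"
      "\<And>\<epsilon>. \<epsilon> > 0 \<Longrightarrow> \<exists>R. \<forall>s\<in>N. s \<in> A \<longrightarrow> nm s \<ge> R \<longrightarrow> \<phi> s > 1 - \<epsilon>"
    using asdisj_Urysohn[OF X(1) subset_trans[OF E(1) X(1)] X(2) E(3)] by metis
  show thesis
  proof (rule that[OF \<phi>(1)])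
    have "eventually (\<lambda>s. \<phi> s = 0) (point_filter N x)" using E(2) by eventually_elim (use E(1) \<phi>(2) in auto)
    then have "((\<lambda>u. 0) \<longlongrightarrow> x \<phi>) (point_filter N x)"
      by (rule Lim_transform_eventually[OF cor_tendsto[OF x(1) \<phi>(1)]])
    then show "x \<phi> = 0" by (rule tendsto_unique[OF cor_nonbot[OF x(1)] _ tendsto_const])
    show "y \<phi> \<ge> 1" if y: "y \<in> tr N A" for y
    proof (rule field_le_epsilon)
      fix e :: real assume "e > 0"
      then obtain R where R: "\<forall>s\<in>N. s \<in> A \<longrightarrow> nm s \<ge> R \<longrightarrow> \<phi> s > 1 - e" using \<phi>(3) by blast
      have "y \<phi> \<ge> 1 - e" by (rule trace_ge[OF N A y \<phi>(1), of R]) (use R A in force)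
      then show "1 \<le> y \<phi> + e" by simp
    qed
  qed
qed

text \<open>A sequence in \<open>E\<close> escaping to infinity has a cluster point in the compact
  cube, and its radial coordinate must be 1.\<close>

lemma unbounded_trace_nonempty:
  assumes N: "net N" and E: "E \<subseteq> N" and unb: "\<And>R. \<exists>s\<in>E. nm s > R"
  shows "tr N E \<noteq> {}"
proof -
  have "\<forall>n. \<exists>s. s \<in> E \<and> nm s > real n" using unb by blast
  then obtain s where s: "\<And>n. s n \<in> E" "\<And>n. nm (s n) > real n" by metis
  have "emb N (s n) \<in> topspace (cube N)" for n using emb_in_cube s E by blast
  then obtain y where y: "y \<in> topspace (cube N)" "\<And>U m. \<lbrakk>openin (cube N) U; y \<in> U\<rbrakk> \<Longrightarrow> \<exists>n\<ge>m. emb N (s n) \<in> U"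
    using compact_space_cluster_point[OF compact_cube, of "\<lambda>n. emb N (s n)" N] by metis
  have cl: "y \<in> cube N closure_of (emb N ` E)"
    unfolding in_closure_of using y s(1) by blast
  then have cp: "y \<in> cpt N" unfolding higson_compact_def using closure_of_mono E by (metis image_mono subsetD)
  have r: "radial N \<in> CH N" using radial_in_Ch net_sub N by blast
  have "y (radial N) \<ge> 1"
  proof (rule ccontr)
    assume less: "\<not> y (radial N) \<ge> 1"
    define \<epsilon> where "\<epsilon> = (1 - y (radial N))/2"
    have \<epsilon>: "\<epsilon> > 0" "y (radial N) < 1 - \<epsilon>" using less by (auto simp: \<epsilon>_def field_simps)
    obtain n where n: "n \<ge> nat \<lceil>1/\<epsilon>\<rceil>" "emb N (s n) (radial N) < 1 - \<epsilon>"
      using y(2)[OF openin_cube_coordinate[OF r, of "{..<1 - \<epsilon>}"]] y(1) \<epsilon> by fastforce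
    have "nm (s n) \<ge> 1/\<epsilon>" using n(1) s(2)[of n] by linarith
    then have "radial N (s n) > 1 - \<epsilon>" using radial_tends[OF \<epsilon>(1)] s(1) E by blast
    then show False using n(2) r by (simp add: higson_emb_def)
  qed
  moreover have "y (radial N) \<le> 1" using y(1) r unfolding topspace_cube by fastforce
  ultimately have "y \<in> cor N" using cp net_cor_iff[OF N] by (simp add: at_infinity_def)
  then have "y \<in> tr N E" using cl in_closure_emb_iff[OF y(1) E] corona_trace_iff[OF E] by blast
  then show ?thesis by blast
qed

text \<open>An unbounded intersection would have a point at infinity lying in both traces.\<close>

lemma disjoint_traces_bounded:
  assumes N: "net N" and "C \<subseteq> N" "Q \<subseteq> N" "tr N C \<inter> tr N Q = {}"
  obtains R where "\<And>s. \<lbrakk>s \<in> C; s \<in> Q\<rbrakk> \<Longrightarrow> nm s \<le> R"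
proof (rule ccontr)
  assume "\<not> thesis"
  then have "\<And>R. \<exists>s\<in>C \<inter> Q. nm s > R" using that by (metis IntI linorder_not_le)
  then have "tr N (C \<inter> Q) \<noteq> {}" using unbounded_trace_nonempty[OF N, of "C \<inter> Q"] assms by blast
  then show False using trace_mono[of "C \<inter> Q" C N] trace_mono[of "C \<inter> Q" Q N] assms by blast
qed

text \<open>Since Q contains the shell 1/2 \<le> g \<le> 2/3, a separator C of Q falls asymptotically into the
  parts g < 7/12 and g \<ge> 7/12, and the inner part alone separates z from everything beyond the shell.\<close>
lemma separator_cut:
  assumes N: "net N" and sub: "C \<subseteq> N" "Q \<subseteq> N" "A \<subseteq> N"
    and U: "openin (subtopology (cube N) (cor N)) U1" "openin (subtopology (cube N) (cor N)) U2"
      "U1 \<inter> U2 = {}" "cor N - tr N C = U1 \<union> U2" "tr N Q \<subseteq> U2"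
    and g: "g \<in> CH N"
    and shell: "{s\<in>N. 1/2 \<le> g s \<and> g s \<le> 2/3 \<and> nm s \<ge> R} \<subseteq> Q"
    and z: "z \<in> U1" "z g < 1/2" and A: "\<forall>y\<in>tr N A. y g > 2/3"
    and dim: "asind_le d x0 m C"
  obtains C1 where "asym_separator N d x0 z A C1" "asind_le d x0 m C1"
proof -
  have X: "N \<subseteq> X" using N net_sub by blast
  have disj: "tr N C \<inter> tr N Q = {}" using U by blast
  obtain R2 where R2: "\<And>s. \<lbrakk>s \<in> C; s \<in> Q\<rbrakk> \<Longrightarrow> nm s \<le> R2"
    using disjoint_traces_bounded[OF N sub(1,2) disj] by metis
  \<comment> \<open>The level 7/12 is the middle of the shell, at distance 1/12 from 1/2 and from
    2/3. A far pair of points of \<open>C\<close> on both sides of it at bounded distance would have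
    its lower point inside the shell, hence in \<open>Q\<close>, which meets \<open>C\<close> only
    in a bounded set.\<close>
  define C1 where "C1 = {s\<in>C. g s < 7/12}"
  have C1: "C1 \<subseteq> C" "C1 \<subseteq> N" "C - C1 \<subseteq> N" using sub by (auto simp: C1_def)
  have "asdisj C1 (C - C1)"
    unfolding asdisj_def
  proof
    fix r
    obtain D where D: "\<And>s t. \<lbrakk>s \<in> N; t \<in> N; nm s \<ge> D; d s t \<le> r\<rbrakk> \<Longrightarrow> \<bar>g s - g t\<bar> < 1/12"
      using ChD_osc[OF X g, of "1/12"] by (metis zero_less_divide_1_iff zero_less_numeral)
    have "nm a \<le> max D (max R R2)" if "a \<in> C1" "b \<in> C - C1" "d a b \<le> r" for a b
    proof (rule ccontr)
      assume "\<not> nm a \<le> max D (max R R2)"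
      then have big: "nm a > D" "nm a > R" "nm a > R2" by auto
      have ab: "a \<in> N" "b \<in> N" "a \<in> C" "g a < 7/12" "g b \<ge> 7/12" using that C1 by (auto simp: C1_def)
      have "\<bar>g a - g b\<bar> < 1/12" using D[of a b] ab big that by auto
      then have "a \<in> Q" using shell ab big by auto
      then show False using R2 ab big by force
    qed
    then show "\<exists>R. \<forall>a\<in>C1. \<forall>b\<in>C - C1. d a b \<le> r \<longrightarrow> nm a \<le> R" by blast
  qed
  then have "asind_le d x0 m C1" using asind_le_clopen[OF dim net_subset[OF N sub(1)] C1(1)] by blast
  moreover have "asym_separator N d x0 z A C1"
  proof -
    let ?T = "subtopology (cube N) (cor N)"
    have top: "cor N \<subseteq> topspace (cube N)" using cpt_subset_cube by (auto simp: higson_corona_def)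
    have op: "openin ?T {y \<in> cor N. y g \<in> V}" if "open V" for V
    proof -
      have "{y \<in> cor N. y g \<in> V} = cor N \<inter> {y \<in> topspace (cube N). y g \<in> V}" using top by blast
      then show ?thesis using openin_subtopology_Int2[OF openin_cube_coordinate[OF g that]] by simp
    qed
    \<comment> \<open>Inside the level the old partition is kept; everything beyond it, including
      the outer part of the trace of \<open>C\<close>, goes to \<open>V2\<close>. No point is lost
      on the level itself, since it lies in the trace of \<open>Q\<close> and hence in
      \<open>U2\<close>.\<close>
    define V1 where "V1 = U1 \<inter> {y \<in> cor N. y g \<in> {..<7/12}}"
    define V2 where "V2 = U2 \<union> {y \<in> cor N. y g \<in> {7/12<..}}"
    have ops: "openin ?T V1" "openin ?T V2" unfolding V1_def V2_def
      by (intro openin_Int openin_Un U(1,2) op; simp)+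
    have le: "y g \<le> 7/12" if "y \<in> tr N C1" for y
      by (rule trace_le[OF N C1(2) that g, of 0]) (auto simp: C1_def)
    have ge: "y g \<ge> 7/12" if "y \<in> tr N (C - C1)" for y
      by (rule trace_ge[OF N C1(3) that g, of 0]) (auto simp: C1_def)
    have eq: "y \<in> tr N Q" if "y \<in> cor N" "y g = 7/12" for y
      by (rule trace_shell[OF N sub(2) that(1) g, of "1/2" "2/3" R]) (use shell that in auto)
    have split: "y \<in> tr N C1 \<or> y \<in> tr N (C - C1)" if "y \<in> tr N C" for y
    proof -
      have "frequently (\<lambda>s. s \<in> C1 \<or> s \<in> C - C1) (point_filter N y)"
        using that corona_trace_iff[OF sub(1)] by (auto elim!: frequently_elim1)
      then show ?thesis
        using that trace_subset_cor unfolding corona_trace_iff[OF C1(2)] corona_trace_iff[OF C1(3)]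
          frequently_disj_iff by blast
    qed
    have subC: "tr N C1 \<subseteq> tr N C" by (rule trace_mono[OF C1(1) sub(1)])
    have "cor N - tr N C1 = V1 \<union> V2"
    proof
      show "V1 \<union> V2 \<subseteq> cor N - tr N C1"
        using U(4) subC le by (fastforce simp: V1_def V2_def)
      show "cor N - tr N C1 \<subseteq> V1 \<union> V2"
      proof
        fix y assume y: "y \<in> cor N - tr N C1"
        show "y \<in> V1 \<union> V2"
        proof (cases "y \<in> tr N C")
          case True
          then have "y g \<ge> 7/12" using split y ge by blast
          moreover have "y g \<noteq> 7/12" using eq y True disj by blast
          ultimately show ?thesis using y by (auto simp: V2_def)
        next
          case False
          then have "y \<in> U1 \<or> y \<in> U2" using U(4) y by blast
          moreover have "y \<in> U2" if "y g = 7/12" using eq y that U(5) by blast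
          ultimately show ?thesis using y by (auto simp: V1_def V2_def) (use not_less_iff_gr_or_eq in blast)
        qed
      qed
    qed
    moreover have "V1 \<inter> V2 = {}" using U(3) by (auto simp: V1_def V2_def)
    moreover have "z \<in> cor N" using z(1) U(4) by blast
    then have "{z} \<subseteq> V1" using z by (auto simp: V1_def)
    moreover have "tr N A \<subseteq> V2" using A trace_subset_cor by (fastforce simp: V2_def)
    moreover have "tr N C1 \<subseteq> cor N" by (rule trace_subset_cor)
    ultimately have "is_partition (cube N) (cor N) {z} (tr N A) (tr N C1)"
      unfolding is_partition_def using ops by blast
    then show ?thesis using C1 by (simp add: asym_separator_def)
  qed
  ultimately show thesis using that by blast
qed

section \<open>Operations on Higson functions of a net\<close>

text \<open>On a net the corona is cut out of the compactification by the closed condition that the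
  radial coordinate be 1.\<close>

lemma compact_cor: 
  assumes N: "net N"
  shows "compact_space (subtopology (cube N) (cor N))" "topspace (subtopology (cube N) (cor N)) = cor N"
proof -
  show "topspace (subtopology (cube N) (cor N)) = cor N"
    using cpt_subset_cube by (auto simp: higson_corona_def)
  have r: "radial N \<in> CH N" using radial_in_Ch net_sub N by blast
  have "cor N = cpt N - {z \<in> topspace (cube N). z (radial N) \<in> - {1}}"
    using net_cor_iff[OF N] cpt_subset_cube by (auto simp: at_infinity_def)
  moreover have "closedin (cube N) (cpt N - {z \<in> topspace (cube N). z (radial N) \<in> - {1}})"
    by (intro closedin_diff openin_cube_coordinate[OF r]) (auto simp: higson_compact_def)
  ultimately have "closedin (cube N) (cor N)" by simp
  then show "compact_space (subtopology (cube N) (cor N))"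
    using closedin_compact_space[OF compact_cube] compact_space_subtopology by blast
qed

text \<open>Evaluation at a corona point is a limit along its filter, so it commutes with continuous
  operations; the Lipschitz bound makes the composite slowly oscillating.\<close>

lemma Ch_Lipschitz_compose:
  assumes N: "net N" and u: "u \<in> CH N" and h: "L-lipschitz_on UNIV h" and range: "h \<in> {0..1} \<rightarrow> {0..1::real}"
  shows "(\<lambda>s\<in>N. h (u s)) \<in> CH N" and "y \<in> cor N \<Longrightarrow> y (\<lambda>s\<in>N. h (u s)) = h (y u)"
proof -
  have L: "L \<ge> 0" using h lipschitz_on_nonneg by blast
  show in_CH: "(\<lambda>s\<in>N. h (u s)) \<in> CH N"
  proof (rule Ch_net[OF N])
    show "(\<lambda>s\<in>N. h (u s)) \<in> N \<rightarrow>\<^sub>E {0..1}"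
      using range ChD_range[OF u] by (intro restrict_PiE_iff[THEN iffD2] ballI) blast
    fix r \<epsilon> :: real assume "r > 0" "\<epsilon> > 0"
    \<comment> \<open>\<open>L + 1\<close> rather than \<open>L\<close>, since \<open>L\<close> may
      be 0.\<close>
    then have "\<epsilon> / (L + 1) > 0" using L by simp
    then obtain D where D: "\<And>s t. \<lbrakk>s \<in> N; t \<in> N; nm s \<ge> D; d s t \<le> r\<rbrakk> \<Longrightarrow> \<bar>u s - u t\<bar> < \<epsilon> / (L + 1)"
      using ChD_osc[OF net_sub[OF N] u] by metis
    have "\<bar>h (u s) - h (u t)\<bar> < \<epsilon>" if "s \<in> N" "t \<in> N" "nm s \<ge> D" "d s t < r" for s t
    proof -
      have "\<bar>h (u s) - h (u t)\<bar> \<le> L * \<bar>u s - u t\<bar>"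
        using lipschitz_onD[OF h, of "u s" "u t"] by (simp add: dist_real_def)
      also have "\<dots> \<le> (L + 1) * \<bar>u s - u t\<bar>" by (intro mult_right_mono) auto
      also have "\<dots> < (L + 1) * (\<epsilon> / (L + 1))" using D[of s t] that L by (intro mult_strict_left_mono) auto
      also have "\<dots> = \<epsilon>" using L by simp
      finally show ?thesis .
    qed
    then show "\<exists>D. \<forall>s\<in>N. \<forall>t\<in>N. nm s \<ge> D \<longrightarrow> d s t < r \<longrightarrow> \<bar>(\<lambda>s\<in>N. h (u s)) s - (\<lambda>s\<in>N. h (u s)) t\<bar> < \<epsilon>"
      by (intro exI[of _ D]) auto
  qed
  show "y (\<lambda>s\<in>N. h (u s)) = h (y u)" if y: "y \<in> cor N"
  proof -
    have "isCont h (y u)" using lipschitz_on_continuous_on[OF h] by (simp add: continuous_on_eq_continuous_at)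
    then have "((\<lambda>s. h (u s)) \<longlongrightarrow> h (y u)) (point_filter N y)"
      using cor_tendsto[OF y u] isCont_tendsto_compose by blast
    moreover have "eventually (\<lambda>s. h (u s) = (\<lambda>s\<in>N. h (u s)) s) (point_filter N y)"
      using eventually_point_filter_in[of N y] by eventually_elim simp
    ultimately have "((\<lambda>s\<in>N. h (u s)) \<longlongrightarrow> h (y u)) (point_filter N y)" by (rule Lim_transform_eventually)
    then show ?thesis using tendsto_unique[OF cor_nonbot[OF y]] cor_tendsto[OF y in_CH] by blast
  qed
qed

lemma Ch_max:
  assumes N: "net N" and u: "u \<in> CH N" and v: "v \<in> CH N"
  shows "(\<lambda>s\<in>N. max (u s) (v s)) \<in> CH N" and "y \<in> cor N \<Longrightarrow> y (\<lambda>s\<in>N. max (u s) (v s)) = max (y u) (y v)"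
proof -
  show in_CH: "(\<lambda>s\<in>N. max (u s) (v s)) \<in> CH N"
  proof (rule Ch_net[OF N])
    show "(\<lambda>s\<in>N. max (u s) (v s)) \<in> N \<rightarrow>\<^sub>E {0..1}"
      using ChD_range[OF u] ChD_range[OF v] by (auto simp: le_max_iff_disj)
    fix r \<epsilon> :: real assume "r > 0" "\<epsilon> > 0"
    obtain D where D: "\<And>s t. \<lbrakk>s \<in> N; t \<in> N; nm s \<ge> D; d s t \<le> r\<rbrakk> \<Longrightarrow> \<bar>u s - u t\<bar> < \<epsilon>"
      using ChD_osc[OF net_sub[OF N] u \<open>\<epsilon> > 0\<close>] by metis
    obtain D' where D': "\<And>s t. \<lbrakk>s \<in> N; t \<in> N; nm s \<ge> D'; d s t \<le> r\<rbrakk> \<Longrightarrow> \<bar>v s - v t\<bar> < \<epsilon>"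
      using ChD_osc[OF net_sub[OF N] v \<open>\<epsilon> > 0\<close>] by metis
    have "\<bar>max (u s) (v s) - max (u t) (v t)\<bar> < \<epsilon>" if "s \<in> N" "t \<in> N" "nm s \<ge> max D D'" "d s t < r" for s t
      using D[of s t] D'[of s t] that by (auto simp: max_def abs_less_iff split: if_splits)
    then show "\<exists>D. \<forall>s\<in>N. \<forall>t\<in>N. nm s \<ge> D \<longrightarrow> d s t < r \<longrightarrow>
        \<bar>(\<lambda>s\<in>N. max (u s) (v s)) s - (\<lambda>s\<in>N. max (u s) (v s)) t\<bar> < \<epsilon>"
      by (intro exI[of _ "max D D'"]) auto
  qed
  show "y (\<lambda>s\<in>N. max (u s) (v s)) = max (y u) (y v)" if y: "y \<in> cor N"
  proof -
    have "((\<lambda>s. max (u s) (v s)) \<longlongrightarrow> max (y u) (y v)) (point_filter N y)"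
      by (intro tendsto_max cor_tendsto[OF y] u v)
    moreover have "eventually (\<lambda>s. max (u s) (v s) = (\<lambda>s\<in>N. max (u s) (v s)) s) (point_filter N y)"
      using eventually_point_filter_in[of N y] by eventually_elim simp
    ultimately have "((\<lambda>s\<in>N. max (u s) (v s)) \<longlongrightarrow> max (y u) (y v)) (point_filter N y)" by (rule Lim_transform_eventually)
    then show ?thesis using tendsto_unique[OF cor_nonbot[OF y]] cor_tendsto[OF y in_CH] by blast
  qed
qed

lemma cor_mono:
  assumes "y \<in> cor N" "u \<in> CH N" "v \<in> CH N" "\<And>s. s \<in> N \<Longrightarrow> c * u s \<le> v s"
  shows "c * y u \<le> y v"
proof (rule tendsto_le[OF cor_nonbot[OF assms(1)] cor_tendsto[OF assms(1,3)]])
  show "((\<lambda>s. c * u s) \<longlongrightarrow> c * y u) (point_filter N y)" by (intro tendsto_intros cor_tendsto assms)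
  show "eventually (\<lambda>s. c * u s \<le> v s) (point_filter N y)"
    using eventually_point_filter_in[of N y] by eventually_elim (use assms in auto)
qed

text \<open>One function vanishing at \<open>x\<close> that dominates a positive multiple of each of
  countably many such functions. Partial sums are slowly oscillating and vanish at \<open>x\<close>,
  the tail after \<open>M\<close> terms is at most \<open>(1/2)^M\<close> uniformly, and the weights
  sum to 1, which keeps the values in the unit interval.\<close>

lemma Ch_weighted_sum:
  assumes N: "net N" and x: "x \<in> cor N" and \<phi>: "\<And>n. \<phi> n \<in> CH N" "\<And>n. x (\<phi> n) = 0"
  obtains u where "u \<in> CH N" "x u = 0" "\<And>n s. s \<in> N \<Longrightarrow> (1/2)^(n+1) * \<phi> n s \<le> u s"
proof -
  define f where "f s n = (1/2)^(n+1) * \<phi> n s" for s n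
  define w where "w s = (\<Sum>n. f s n)" for s
  define p where "p M s = (\<Sum>n<M. f s n)" for M s
  have r: "0 \<le> \<phi> n s \<and> \<phi> n s \<le> 1" if "s \<in> N" for n s using ChD_range[OF \<phi>(1) that] by simp
  have f: "0 \<le> f s n" "f s n \<le> (1/2)^(n+1)" if "s \<in> N" for s n
    using r[OF that, of n] by (auto simp: f_def)
  have geo: "(\<lambda>n. (1/2::real)^(n+1)) sums 1"
    using power_half_series by simp
  have sf: "summable (f s)" if "s \<in> N" for s
    by (rule summable_comparison_test'[OF sums_summable[OF geo], of 0]) (use f[OF that] in auto)
  have tail: "0 \<le> w s - p M s \<and> w s - p M s \<le> (1/2)^M" if "s \<in> N" for s M
  proof -
    have eq: "w s - p M s = (\<Sum>n. f s (n + M))"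
      unfolding w_def p_def using suminf_minus_initial_segment[OF sf[OF that]] by simp
    have sm: "summable (\<lambda>n. f s (n + M))" using sf[OF that] summable_ignore_initial_segment by blast
    have g2: "(\<lambda>n. (1/2::real)^M * (1/2)^(n+1)) sums ((1/2)^M * 1)" by (rule sums_mult[OF geo])
    have "(\<Sum>n. f s (n + M)) \<le> (\<Sum>n. (1/2::real)^M * (1/2)^(n+1))"
      by (rule suminf_le[OF _ sm sums_summable[OF g2]]) 
         (use f(2)[OF that] in \<open>metis add.assoc add.commute power_add\<close>)
    then show ?thesis using eq suminf_nonneg[OF sm] f(1)[OF that] sums_unique[OF g2] by simp
  qed
  have u: "(\<lambda>s\<in>N. w s) \<in> CH N"
  proof (rule Ch_net[OF N])
    show "(\<lambda>s\<in>N. w s) \<in> N \<rightarrow>\<^sub>E {0..1}"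
      using tail[of _ 0] by (auto simp: p_def)
    fix r \<epsilon> :: real assume "r > 0" "\<epsilon> > 0"
    then obtain M where M: "(1/2)^M < \<epsilon>/2"
      using real_arch_pow_inv[of "\<epsilon>/2" "1/2"] by auto
    have "\<exists>D. \<forall>s\<in>N. \<forall>t\<in>N. nm s \<ge> D \<longrightarrow> d s t < r \<longrightarrow> \<bar>p M s - p M t\<bar> \<le> \<epsilon>/2"
    proof -
      have "\<exists>D. \<forall>s\<in>N. \<forall>t\<in>N. nm s \<ge> D \<longrightarrow> d s t \<le> r \<longrightarrow> \<bar>\<phi> n s - \<phi> n t\<bar> < \<epsilon>/2" for n
        using ChD_osc[OF net_sub[OF N] \<phi>(1), of "\<epsilon>/2"] \<open>\<epsilon> > 0\<close> by (metis half_gt_zero)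
      then obtain D where D: "\<And>n s t. \<lbrakk>s \<in> N; t \<in> N; nm s \<ge> D n; d s t \<le> r\<rbrakk> \<Longrightarrow> \<bar>\<phi> n s - \<phi> n t\<bar> < \<epsilon>/2"
        by metis
      define K where "K = Max (insert 0 (D ` {..<M}))"
      have K: "D n \<le> K" if "n < M" for n using that by (auto simp: K_def)
      have "\<bar>p M s - p M t\<bar> \<le> \<epsilon>/2" if st: "s \<in> N" "t \<in> N" "nm s \<ge> K" "d s t < r" for s t
      proof -
        have "\<bar>p M s - p M t\<bar> = \<bar>\<Sum>n<M. (1/2)^(n+1) * (\<phi> n s - \<phi> n t)\<bar>"
          by (simp only: p_def f_def sum_subtractf[symmetric] right_diff_distrib)
        also have "\<dots> \<le> (\<Sum>n<M. \<bar>(1/2)^(n+1) * (\<phi> n s - \<phi> n t)\<bar>)" by (rule sum_abs)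
        also have "\<dots> \<le> (\<Sum>n<M. (1/2)^(n+1) * (\<epsilon>/2))"
        proof (rule sum_mono)
          fix n assume "n \<in> {..<M}"
          then have "\<bar>\<phi> n s - \<phi> n t\<bar> < \<epsilon>/2" using D[of s t n] K[of n] st by auto
          then show "\<bar>(1/2)^(n+1) * (\<phi> n s - \<phi> n t)\<bar> \<le> (1/2)^(n+1) * (\<epsilon>/2)"
            unfolding abs_mult by (intro mult_mono) auto
        qed
        also have "\<dots> = (\<Sum>n<M. (1/2)^(n+1)) * (\<epsilon>/2)" by (rule sum_distrib_right[symmetric])
        also have "\<dots> \<le> 1 * (\<epsilon>/2)"
          using sum_le_suminf[OF sums_summable[OF geo], of "{..<M}"] sums_unique[OF geo] \<open>\<epsilon> > 0\<close>
          by (intro mult_right_mono) auto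
        finally show ?thesis by simp
      qed
      then show ?thesis by blast
    qed
    then obtain D where D: "\<And>s t. \<lbrakk>s \<in> N; t \<in> N; nm s \<ge> D; d s t < r\<rbrakk> \<Longrightarrow> \<bar>p M s - p M t\<bar> \<le> \<epsilon>/2" by metis
    have "\<bar>w s - w t\<bar> < \<epsilon>" if "s \<in> N" "t \<in> N" "nm s \<ge> D" "d s t < r" for s t
      using D[OF that] tail[OF that(1), of M] tail[OF that(2), of M] M by linarith
    then show "\<exists>D. \<forall>s\<in>N. \<forall>t\<in>N. nm s \<ge> D \<longrightarrow> d s t < r \<longrightarrow> \<bar>(\<lambda>s\<in>N. w s) s - (\<lambda>s\<in>N. w s) t\<bar> < \<epsilon>"
      by (intro exI[of _ D]) auto
  qed
  moreover have "x (\<lambda>s\<in>N. w s) = 0"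
  proof -
    have up: "x (\<lambda>s\<in>N. w s) \<le> (1/2)^M" for M
    proof (rule tendsto_le[OF cor_nonbot[OF x] _ cor_tendsto[OF x u]])
      have "((\<lambda>s. p M s + (1/2)^M) \<longlongrightarrow> (\<Sum>n<M. (1/2)^(n+1) * x (\<phi> n)) + (1/2)^M) (point_filter N x)"
        unfolding p_def f_def by (intro tendsto_intros cor_tendsto[OF x] \<phi>(1))
      then show "((\<lambda>s. p M s + (1/2)^M) \<longlongrightarrow> (1/2)^M) (point_filter N x)" by (simp add: \<phi>(2))
      show "eventually (\<lambda>s. (\<lambda>s\<in>N. w s) s \<le> p M s + (1/2)^M) (point_filter N x)"
        using eventually_point_filter_in[of N x] by eventually_elim (use tail[of _ M] in force)
    qed
    have "\<not> x (\<lambda>s\<in>N. w s) > 0"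
    proof
      assume "x (\<lambda>s\<in>N. w s) > 0"
      then obtain M where "(1/2)^M < x (\<lambda>s\<in>N. w s)"
        using real_arch_pow_inv[of "x (\<lambda>s\<in>N. w s)" "1/2"] by auto
      then show False using up[of M] by simp
    qed
    moreover have "x (\<lambda>s\<in>N. w s) \<ge> 0"
      using x u cpt_subset_cube unfolding higson_corona_def topspace_cube by fastforce
    ultimately show ?thesis by simp
  qed
  moreover have "(1/2)^(n+1) * \<phi> n s \<le> (\<lambda>s\<in>N. w s) s" if "s \<in> N" for n s
  proof -
    have "f s n \<le> w s" using sum_le_suminf[OF sf[OF that], of "{n}"] f(1)[OF that] by (simp add: w_def)
    then show ?thesis using that by (simp add: f_def)
  qed
  ultimately show thesis using that by blast
qed

section \<open>Uniform bounds on separators\<close>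

text \<open>A witness against \<open>asind_le d x0 (int n + 1) N\<close>: the pair has no separator
  of the dimension that this bound would allow.\<close>

definition hard_point :: "'a set \<Rightarrow> nat \<Rightarrow> (('a \<Rightarrow> real) \<Rightarrow> real) \<Rightarrow> 'a set \<Rightarrow> bool" where
  "hard_point N n x A \<longleftrightarrow> x \<in> cor N \<and> A \<subseteq> N \<and> x \<notin> tr N A \<and>
     (\<forall>C. asym_separator N d x0 x A C \<longrightarrow> \<not> asind_le d x0 (int n) C)"

lemma hard_point_antimono: "hard_point N n x A \<Longrightarrow> m \<le> n \<Longrightarrow> hard_point N m x A"
  unfolding hard_point_def using asind_le_mono by (metis of_nat_mono)

text \<open>The point is fixed and only the sets \<open>A n\<close> vary. All shells are taken as
  level strips of a single function \<open>u\<close> at geometrically decreasing levels, which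
  separates them from each other.\<close>

lemma single_hard_point_impossible:
  assumes N: "net N"
    and sep: "\<And>x A. \<lbrakk>x \<in> cor N; A \<subseteq> N; x \<notin> tr N A\<rbrakk> \<Longrightarrow> \<exists>C n. asym_separator N d x0 x A C \<and> asind_le d x0 n C"
    and hard: "\<And>n. hard_point N n x (A n)"
  shows False
proof -
  have X: "N \<subseteq> X" using N net_sub by blast
  have x: "x \<in> cor N" and A: "\<And>n. A n \<subseteq> N" "\<And>n. x \<notin> tr N (A n)" using hard by (auto simp: hard_point_def)
  have "\<exists>\<phi>. \<phi> \<in> CH N \<and> x \<phi> = 0 \<and> (\<forall>y\<in>tr N (A n). y \<phi> \<ge> 1)" for n
    using trace_separating_function[OF N A(1) x A(2)] by metis
  then obtain \<phi> where \<phi>: "\<And>n. \<phi> n \<in> CH N" "\<And>n. x (\<phi> n) = 0" "\<And>n y. y \<in> tr N (A n) \<Longrightarrow> y (\<phi> n) \<ge> 1"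
    by metis
  obtain u where u: "u \<in> CH N" "x u = 0" "\<And>n s. s \<in> N \<Longrightarrow> (1/2)^(n+1) * \<phi> n s \<le> u s"
    using Ch_weighted_sum[OF N x, of \<phi>] \<phi>(1,2) by metis
  \<comment> \<open>The factor undoes the weight of the n-th summand of \<open>u\<close>, so that
    \<open>g n\<close> reaches 1 on the trace of \<open>A n\<close>.\<close>
  define h where "h n t = min 1 (2^(n+1) * t)" for n :: nat and t :: real
  have hL: "(2^(n+1))-lipschitz_on UNIV (h n)" for n
  proof (rule lipschitz_onI)
    fix a b :: real
    have "\<bar>h n a - h n b\<bar> \<le> \<bar>2^(n+1) * a - 2^(n+1) * b\<bar>" unfolding h_def by (auto simp: min_def)
    also have "\<dots> = 2^(n+1) * \<bar>a - b\<bar>" by (simp only: right_diff_distrib[symmetric] abs_mult) simp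
    finally show "dist (h n a) (h n b) \<le> 2^(n+1) * dist a b" by (simp add: dist_real_def)
  qed simp
  define g where "g n = (\<lambda>s\<in>N. h n (u s))" for n
  have g: "g n \<in> CH N" "\<And>y. y \<in> cor N \<Longrightarrow> y (g n) = h n (y u)" for n
    using Ch_Lipschitz_compose[OF N u(1) hL] by (auto simp: g_def h_def)
  have gu: "g n s = min 1 (2^(n+1) * u s)" if "s \<in> N" for n s
    using ChD_range[OF u(1) that] that by (simp add: g_def h_def)
  have big: "y (g n) > 2/3" if y: "y \<in> tr N (A n)" for n y
  proof -
    have yc: "y \<in> cor N" using y trace_subset_cor by blast
    have "(1/2)^(n+1) * y (\<phi> n) \<le> y u" by (rule cor_mono[OF yc \<phi>(1) u(1)]) (rule u(3))
    then have "y (\<phi> n) \<le> 2^(n+1) * y u" by (simp add: field_simps power_divide)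
    then have "1 \<le> 2^(n+1) * y u" using \<phi>(3)[OF y] by linarith
    then show ?thesis unfolding g(2)[OF yc] h_def by simp
  qed
  define Q where "Q n = {s\<in>N. 1/2 \<le> g n s \<and> g n s \<le> 2/3}" for n
  have QX: "Q n \<subseteq> X" "Q n \<subseteq> N" for n using X by (auto simp: Q_def)
  \<comment> \<open>On \<open>Q i\<close> the rescaled \<open>u\<close> is at least 1/2, so one
    further doubling already makes \<open>g j\<close> equal to 1, while \<open>g j\<close> is at
    most 2/3 on \<open>Q j\<close>. The bounds 1/2 and 2/3 leave exactly this gap.\<close>
  have lt: "asdisj (Q i) (Q j)" if "i < j" for i j
  proof (rule asdisj_mono[OF asdisj_gap(2)[OF X g(1)[of j], of "2/3" 1]])
    show "Q i \<subseteq> {s \<in> N. 1 \<le> g j s}"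
    proof
      fix s assume s: "s \<in> Q i"
      then have sN: "s \<in> N" and "1/2 \<le> 2^(i+1) * u s" using gu[of s i] by (auto simp: Q_def)
      then have "1 \<le> 2^(i+2) * u s" by simp
      also have "\<dots> \<le> 2^(j+1) * u s"
        using that ChD_range[OF u(1) sN] by (intro mult_right_mono power_increasing) auto
      finally show "s \<in> {s \<in> N. 1 \<le> g j s}" using gu[OF sN] sN by simp
    qed
  qed (auto simp: Q_def)
  \<comment> \<open>The shells descend to the level \<open>u = 0\<close> of \<open>x\<close>, so the
    trace of their union may contain \<open>x\<close>. Splitting by parity lets the diagonal choice
    produce two unions with disjoint traces, and \<open>x\<close> misses one of them.\<close>
  have "asdisj (Q (2*i)) (Q (2*j+1))" for i j
  proof -
    have "2*i < 2*j+1 \<or> 2*j+1 < 2*i" by presburger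
    then show ?thesis using asdisj_sym[OF QX(1) QX(1) lt[of "2*j+1" "2*i"]] lt[of "2*i" "2*j+1"] by blast
  qed
  then obtain R where R: "asdisj (\<Union>i. {s\<in>Q (2*i). nm s \<ge> R i}) (\<Union>j. {s\<in>Q (2*j+1). nm s \<ge> R j})"
    using asdisj_diagonal[of "\<lambda>i. Q (2*i)" "\<lambda>j. Q (2*j+1)"] QX(1) by metis
  define B where "B e = (\<Union>i. {s\<in>Q (2*i+e). nm s \<ge> R i})" for e
  have BN: "B e \<subseteq> N" for e using QX by (auto simp: B_def)
  have "tr N (B 0) \<inter> tr N (B 1) = {}"
    by (rule asdisj_trace_disjoint[OF N BN BN]) (use R in \<open>simp add: B_def\<close>)
  then obtain e where e: "x \<notin> tr N (B e)" by blast
  obtain C m where C: "asym_separator N d x0 x (B e) C" "asind_le d x0 m C" using sep[OF x BN e] by blast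
  obtain U1 U2 where U: "openin (subtopology (cube N) (cor N)) U1" "openin (subtopology (cube N) (cor N)) U2"
      "U1 \<inter> U2 = {}" "cor N - tr N C = U1 \<union> U2" "{x} \<subseteq> U1" "tr N (B e) \<subseteq> U2" "C \<subseteq> N"
    using C(1) unfolding asym_separator_def is_partition_def by blast
  \<comment> \<open>Any index of the surviving parity with \<open>n \<ge> m\<close> would do; the
    cutoff of the shell \<open>Q n\<close> inside \<open>B e\<close> is \<open>R i\<close>.\<close>
  define i where "i = nat m"
  define n where "n = 2*i+e"
  have xg: "x (g n) < 1/2" using g(2)[OF x] u(2) by (simp add: h_def)
  have shell: "{s\<in>N. 1/2 \<le> g n s \<and> g n s \<le> 2/3 \<and> nm s \<ge> R i} \<subseteq> B e"
    by (auto simp: B_def Q_def n_def)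
  have xU: "x \<in> U1" and bigA: "\<forall>y\<in>tr N (A n). y (g n) > 2/3" using U(5) big by auto
  obtain C1 where C1: "asym_separator N d x0 x (A n) C1" "asind_le d x0 m C1"
    by (rule separator_cut[OF N U(7) BN A(1) U(1-4,6) g(1) shell xU xg bigA C(2)])
  have "m \<le> int n" by (simp add: n_def i_def)
  then have "asind_le d x0 (int n) C1" by (rule asind_le_mono[OF C1(2)])
  then show False using hard[of n] C1(1) by (simp add: hard_point_def)
qed

lemma cor_cluster_point:
  fixes z :: "nat \<Rightarrow> ('a \<Rightarrow> real) \<Rightarrow> real"
  assumes N: "net N" and z: "\<And>n. z n \<in> cor N"
  obtains x where "x \<in> cor N" "\<And>U m. \<lbrakk>openin (subtopology (cube N) (cor N)) U; x \<in> U\<rbrakk> \<Longrightarrow> \<exists>n\<ge>m. z n \<in> U"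
    "\<And>\<phi> V m. \<lbrakk>\<phi> \<in> CH N; open V; x \<phi> \<in> V\<rbrakk> \<Longrightarrow> \<exists>n\<ge>m. z n \<phi> \<in> V"
proof -
  let ?T = "subtopology (cube N) (cor N)"
  obtain x where x: "x \<in> cor N" "\<And>U m. \<lbrakk>openin ?T U; x \<in> U\<rbrakk> \<Longrightarrow> \<exists>n\<ge>m. z n \<in> U"
    using compact_space_cluster_point[OF compact_cor(1)[OF N], of z] z unfolding compact_cor(2)[OF N] by metis
  show thesis
  proof (rule that[OF x])
    fix \<phi> V and m :: nat assume \<phi>: "\<phi> \<in> CH N" "open V" "x \<phi> \<in> V"
    have "openin ?T (cor N \<inter> {z \<in> topspace (cube N). z \<phi> \<in> V})"
      using openin_subtopology_Int2[OF openin_cube_coordinate[OF \<phi>(1,2)]] .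
    moreover have "x \<in> cor N \<inter> {z \<in> topspace (cube N). z \<phi> \<in> V}"
      using x(1) \<phi>(3) cpt_subset_cube by (auto simp: higson_corona_def)
    ultimately obtain n where "n \<ge> m" "z n \<in> cor N \<inter> {z \<in> topspace (cube N). z \<phi> \<in> V}" using x(2) by blast
    then show "\<exists>n\<ge>m. z n \<phi> \<in> V" by blast
  qed
qed

lemma cor_range:
  assumes "y \<in> cor N" "\<phi> \<in> CH N" shows "y \<phi> \<in> {0..1}"
  using assms cpt_subset_cube unfolding higson_corona_def topspace_cube by fastforce

text \<open>Distinct corona points differ in some coordinate; taking the distance of that coordinate
  to its value at \<open>x\<close> makes it vanish at \<open>x\<close>.\<close>

lemma cor_separating_function:
  assumes N: "net N" and x: "x \<in> cor N" and y: "y \<in> cor N" "y \<noteq> x"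
  obtains v where "v \<in> CH N" "x v = 0" "y v > 0"
proof -
  have "x \<in> CH N \<rightarrow>\<^sub>E {0..1}" "y \<in> CH N \<rightarrow>\<^sub>E {0..1}"
    using x y cpt_subset_cube unfolding higson_corona_def topspace_cube[symmetric] by auto
  then obtain \<psi> where \<psi>: "\<psi> \<in> CH N" "y \<psi> \<noteq> x \<psi>" using y(2) PiE_ext by metis
  define h where "h t = \<bar>t - x \<psi>\<bar>" for t
  have L: "1-lipschitz_on UNIV h" by (rule lipschitz_onI) (auto simp: h_def dist_real_def)
  have R: "h \<in> {0..1} \<rightarrow> {0..1}"
    using cor_range[OF x \<psi>(1)] by (auto simp: h_def abs_le_iff)
  note c = Ch_Lipschitz_compose[OF N \<psi>(1) L R]
  show thesis
    by (rule that[OF c(1)]) (use c(2)[OF x] c(2)[OF y(1)] \<psi>(2) in \<open>auto simp: h_def\<close>)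
qed

text \<open>The cluster point \<open>x\<close> serves only to produce a function \<open>u\<close>
  that vanishes at \<open>x\<close>, is positive at every \<open>Y n\<close>, and takes arbitrarily
  small values on the sequence. Well separated levels of \<open>u\<close> then give the chosen
  points their disjoint strips.\<close>

lemma hard_sequence_impossible:
  assumes N: "net N"
    and sep: "\<And>x A. \<lbrakk>x \<in> cor N; A \<subseteq> N; x \<notin> tr N A\<rbrakk> \<Longrightarrow> \<exists>C n. asym_separator N d x0 x A C \<and> asind_le d x0 n C"
    and hard: "\<And>n. hard_point N n (Y n) (A n)" and x: "x \<in> cor N" and ne: "\<And>n. Y n \<noteq> x"
    and cluster: "\<And>\<phi> V m. \<lbrakk>\<phi> \<in> CH N; open V; x \<phi> \<in> V\<rbrakk> \<Longrightarrow> \<exists>n\<ge>m. Y n \<phi> \<in> V"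
  shows False
proof -
  have X: "N \<subseteq> X" using N net_sub by blast
  have Y: "\<And>n. Y n \<in> cor N" and A: "\<And>n. A n \<subseteq> N" "\<And>n. Y n \<notin> tr N (A n)" using hard by (auto simp: hard_point_def)
  have "\<exists>\<phi>. \<phi> \<in> CH N \<and> Y n \<phi> = 0 \<and> (\<forall>y\<in>tr N (A n). y \<phi> \<ge> 1)" for n
    using trace_separating_function[OF N A(1) Y A(2)] by metis
  then obtain \<phi> where \<phi>: "\<And>n. \<phi> n \<in> CH N" "\<And>n. Y n (\<phi> n) = 0" "\<And>n y. y \<in> tr N (A n) \<Longrightarrow> y (\<phi> n) \<ge> 1"
    by metis
  have "\<exists>v. v \<in> CH N \<and> x v = 0 \<and> Y n v > 0" for n
    using cor_separating_function[OF N x Y ne] by metis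
  then obtain v where v: "\<And>n. v n \<in> CH N" "\<And>n. x (v n) = 0" "\<And>n. Y n (v n) > 0" by metis
  obtain u where u: "u \<in> CH N" "x u = 0" "\<And>n s. s \<in> N \<Longrightarrow> (1/2)^(n+1) * v n s \<le> u s"
    using Ch_weighted_sum[OF N x, of v] v(1,2) by metis
  have Yu: "Y n u > 0" for n
  proof -
    have "(1/2)^(n+1) * Y n (v n) \<le> Y n u" by (rule cor_mono[OF Y v(1) u(1)]) (rule u(3))
    moreover have "(1/2)^(n+1) * Y n (v n) > 0" using v(3) by simp
    ultimately show ?thesis by linarith
  qed
  \<comment> \<open>The ratio 4 keeps the strips around the levels apart: a shell stays within a
    factor 2/3 to 4/3 of its level, a core within 5/6 to 7/6.\<close>
  have "\<exists>\<sigma>. \<forall>k. True \<and> (\<sigma> k < \<sigma> (Suc k) \<and> Y (\<sigma> (Suc k)) u < Y (\<sigma> k) u / 4)"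
  proof (rule dependent_nat_choice)
    fix a :: nat
    have "x u \<in> {..<Y a u / 4}" using u(2) Yu by simp
    then obtain n where "n \<ge> Suc a" "Y n u \<in> {..<Y a u / 4}" using cluster[OF u(1) open_lessThan] by blast
    then show "\<exists>b. True \<and> a < b \<and> Y b u < Y a u / 4" by (intro exI[of _ n]) auto
  qed auto
  then obtain \<sigma> where \<sigma>: "\<And>k. \<sigma> k < \<sigma> (Suc k)" "\<And>k. Y (\<sigma> (Suc k)) u < Y (\<sigma> k) u / 4" by blast
  have \<sigma>ge: "k \<le> \<sigma> k" for k by (rule seq_suble) (simp add: strict_mono_Suc_iff \<sigma>(1))
  define c where "c k = Y (\<sigma> k) u" for k
  have c: "c k > 0" for k using Yu by (simp add: c_def)
  have cS: "c (Suc k) < c k / 4" for k using \<sigma>(2) by (simp add: c_def)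
  have "c (Suc k) \<le> c k" for k using cS[of k] c[of k] by linarith
  then have dec: "decseq c" by (rule decseq_SucI)
  have cc: "c j \<le> c i / 4" if "i < j" for i j
    using decseqD[OF dec Suc_leI[OF that]] cS[of i] by linarith
  \<comment> \<open>A truncated tent, 0 at the level \<open>c k\<close> and 1 at relative distance
    1/2 from it. In the maximum defining \<open>g k\<close> it confines the values below 1 to the
    k-th strip, while the other term handles \<open>A (\<sigma> k)\<close>.\<close>
  define h where "h k t = min 1 (2 / c k * \<bar>t - c k\<bar>)" for k :: nat and t :: real
  have hL: "(2 / c k)-lipschitz_on UNIV (h k)" for k
  proof (rule lipschitz_onI)
    fix a b :: real
    have "\<bar>h k a - h k b\<bar> \<le> \<bar>2 / c k * \<bar>a - c k\<bar> - 2 / c k * \<bar>b - c k\<bar>\<bar>" unfolding h_def by (auto simp: min_def)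
    also have "\<dots> = 2 / c k * \<bar>\<bar>a - c k\<bar> - \<bar>b - c k\<bar>\<bar>"
      using c[of k] by (simp only: right_diff_distrib[symmetric] abs_mult) simp
    also have "\<dots> \<le> 2 / c k * \<bar>a - b\<bar>" using c[of k] by (intro mult_left_mono) auto
    finally show "dist (h k a) (h k b) \<le> 2 / c k * dist a b" by (simp add: dist_real_def)
  qed (use c[of k] in simp)
  have hR: "h k \<in> {0..1} \<rightarrow> {0..1}" for k using c[of k] by (auto simp: h_def)
  note hc = Ch_Lipschitz_compose[OF N u(1) hL hR]
  define g where "g k = (\<lambda>s\<in>N. max (\<phi> (\<sigma> k) s) ((\<lambda>s\<in>N. h k (u s)) s))" for k
  have g: "g k \<in> CH N" "\<And>y. y \<in> cor N \<Longrightarrow> y (g k) = max (y (\<phi> (\<sigma> k))) (h k (y u))" for k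
    using Ch_max[OF N \<phi>(1)[of "\<sigma> k"] hc(1)[of k]] hc(2)[of _ k] by (auto simp: g_def)
  have gh: "h k (u s) \<le> g k s" if "s \<in> N" for k s using that by (simp add: g_def)
  have near: "\<bar>u s - c k\<bar> \<le> c k * t / 2" if "s \<in> N" "g k s \<le> t" "t < 1" for s k t
  proof -
    have "2 / c k * \<bar>u s - c k\<bar> \<le> t" using gh[OF that(1), of k] that by (auto simp: h_def)
    then show ?thesis using c[of k] by (simp add: field_simps)
  qed
  have gz: "Y (\<sigma> k) (g k) = 0" for k using g(2)[OF Y] \<phi>(2) by (simp add: h_def c_def)
  have big: "y (g k) > 2/3" if y: "y \<in> tr N (A (\<sigma> k))" for k y
  proof -
    have "y \<in> cor N" using y trace_subset_cor by blast
    then have "y (\<phi> (\<sigma> k)) \<le> y (g k)" by (simp only: g(2) max.cobounded1)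
    then show ?thesis using \<phi>(3)[OF y] by linarith
  qed
  \<comment> \<open>The cores: \<open>Y (\<sigma> k)\<close> has value 0 under \<open>g k\<close>
    and so lies in the trace of \<open>P k\<close>. The gap from 1/3 to 1/2 separates a core from
    its own shell; the strips of \<open>u\<close> separate it from the others.\<close>
  define P where "P k = {s\<in>N. g k s \<le> 1/3}" for k
  define Q where "Q k = {s\<in>N. 1/2 \<le> g k s \<and> g k s \<le> 2/3}" for k
  have sub: "P k \<subseteq> N" "Q k \<subseteq> N" "P k \<subseteq> X" "Q k \<subseteq> X" for k using X by (auto simp: P_def Q_def)
  have nearP: "5 * c i / 6 \<le> u s" "u s \<le> 7 * c i / 6" if "s \<in> P i" for s i
  proof -
    have "\<bar>u s - c i\<bar> \<le> c i * (1/3) / 2" by (rule near) (use that in \<open>auto simp: P_def\<close>)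
    then show "5 * c i / 6 \<le> u s" "u s \<le> 7 * c i / 6" by linarith+
  qed
  have nearQ: "2 * c j / 3 \<le> u s" "u s \<le> 4 * c j / 3" if "s \<in> Q j" for s j
  proof -
    have "\<bar>u s - c j\<bar> \<le> c j * (2/3) / 2" by (rule near) (use that in \<open>auto simp: Q_def\<close>)
    then show "2 * c j / 3 \<le> u s" "u s \<le> 4 * c j / 3" by linarith+
  qed
  have "asdisj (P i) (Q j)" for i j
  proof -
    consider "i = j" | "i < j" | "j < i" by linarith
    then show ?thesis
    proof cases
      case 1
      show ?thesis
        by (rule asdisj_mono[OF asdisj_gap(1)[OF X g(1)[of i], of "1/3" "1/2"]]) (auto simp: P_def Q_def 1)
    next
      case 2
      show ?thesis
      proof (rule asdisj_mono[OF asdisj_gap(2)[OF X u(1), of "c i / 3" "5 * c i / 6"]])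
        show "P i \<subseteq> {s \<in> N. 5 * c i / 6 \<le> u s}" using nearP sub by blast
        show "Q j \<subseteq> {s \<in> N. u s \<le> c i / 3}" using nearQ(2)[of _ j] cc[OF 2] sub(2)[of j] by fastforce
      qed (use c[of i] in simp)
    next
      case 3
      show ?thesis
      proof (rule asdisj_mono[OF asdisj_gap(1)[OF X u(1), of "7 * c j / 24" "2 * c j / 3"]])
        show "P i \<subseteq> {s \<in> N. u s \<le> 7 * c j / 24}" using nearP(2)[of _ i] cc[OF 3] sub(1)[of i] by fastforce
        show "Q j \<subseteq> {s \<in> N. 2 * c j / 3 \<le> u s}" using nearQ sub by blast
      qed (use c[of j] in simp)
    qed
  qed
  then obtain R where R: "asdisj (\<Union>i. {s\<in>P i. nm s \<ge> R i}) (\<Union>j. {s\<in>Q j. nm s \<ge> R j})"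
    using asdisj_diagonal[of P Q] sub by metis
  define PP where "PP = (\<Union>i. {s\<in>P i. nm s \<ge> R i})"
  define QQ where "QQ = (\<Union>j. {s\<in>Q j. nm s \<ge> R j})"
  have SN: "PP \<subseteq> N" "QQ \<subseteq> N" "PP \<subseteq> X" "QQ \<subseteq> X" using sub unfolding PP_def QQ_def by blast+
  \<comment> \<open>Thinning out may lose \<open>x\<close> as a cluster point, so a fresh one is
    taken for the subsequence.\<close>
  obtain x' where x': "x' \<in> cor N"
      "\<And>U m. \<lbrakk>openin (subtopology (cube N) (cor N)) U; x' \<in> U\<rbrakk> \<Longrightarrow> \<exists>k\<ge>m. Y (\<sigma> k) \<in> U"
      "\<And>\<phi> V m. \<lbrakk>\<phi> \<in> CH N; open V; x' \<phi> \<in> V\<rbrakk> \<Longrightarrow> \<exists>k\<ge>m. Y (\<sigma> k) \<phi> \<in> V"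
    using cor_cluster_point[OF N, of "\<lambda>k. Y (\<sigma> k)"] Y by metis
  have "x' \<notin> tr N QQ"
  proof
    assume inQ: "x' \<in> tr N QQ"
    obtain \<psi> where \<psi>: "\<psi> \<in> CH N" "\<And>s. \<lbrakk>s \<in> N; s \<in> PP\<rbrakk> \<Longrightarrow> \<psi> s = 0"
        "\<And>\<epsilon>. \<epsilon> > 0 \<Longrightarrow> \<exists>R. \<forall>s\<in>N. s \<in> QQ \<longrightarrow> nm s \<ge> R \<longrightarrow> \<psi> s > 1 - \<epsilon>"
      using asdisj_Urysohn[OF X SN(3,4) R[folded PP_def QQ_def]] by metis
    obtain R' where R': "\<And>s. \<lbrakk>s \<in> N; s \<in> QQ; nm s \<ge> R'\<rbrakk> \<Longrightarrow> \<psi> s > 1/2" using \<psi>(3)[of "1/2"] by auto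
    have "x' \<psi> \<ge> 1/2"
      by (rule trace_ge[OF N SN(2) inQ \<psi>(1), of R']) (use R' SN in force)
    then have "x' \<psi> \<in> {1/4<..}" by simp
    then obtain k where k: "Y (\<sigma> k) \<psi> > 1/4" using x'(3)[OF \<psi>(1) open_greaterThan] by blast
    \<comment> \<open>The lower bound -1 is a dummy below the value 0; only the upper bound 1/3
      restricts. A function vanishing on the cores is thus at most 0 at every chosen point, so it
      cannot be 1/2 or more at their cluster point.\<close>
    have "Y (\<sigma> k) \<in> tr N PP"
      by (rule trace_shell[OF N SN(1) Y g(1)[of k], of "-1" "1/3" "R k"])
         (use gz in \<open>auto simp: PP_def P_def intro!: exI[of _ k]\<close>)
    then have "Y (\<sigma> k) \<psi> \<le> 0"
      by (rule trace_le[OF N SN(1) _ \<psi>(1), of _ 0]) (use \<psi>(2) SN in force)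
    then show False using k by simp
  qed
  then obtain C m where C: "asym_separator N d x0 x' QQ C" "asind_le d x0 m C" using sep[OF x'(1) SN(2)] by blast
  obtain U1 U2 where U: "openin (subtopology (cube N) (cor N)) U1" "openin (subtopology (cube N) (cor N)) U2"
      "U1 \<inter> U2 = {}" "cor N - tr N C = U1 \<union> U2" "{x'} \<subseteq> U1" "tr N QQ \<subseteq> U2" "C \<subseteq> N"
    using C(1) unfolding asym_separator_def is_partition_def by blast
  \<comment> \<open>The separator was made for \<open>x'\<close>, but its inner open set contains
    chosen points of arbitrarily large index, and one of these with
    \<open>\<sigma> k \<ge> m\<close> is the point to be separated.\<close>
  obtain k where k: "k \<ge> nat m" "Y (\<sigma> k) \<in> U1" using x'(2)[OF U(1)] U(5) by blast
  have shell: "{s\<in>N. 1/2 \<le> g k s \<and> g k s \<le> 2/3 \<and> nm s \<ge> R k} \<subseteq> QQ"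
    by (auto simp: QQ_def Q_def)
  have small: "Y (\<sigma> k) (g k) < 1/2" and bigA: "\<forall>y\<in>tr N (A (\<sigma> k)). y (g k) > 2/3" using gz big by auto
  obtain C1 where C1: "asym_separator N d x0 (Y (\<sigma> k)) (A (\<sigma> k)) C1" "asind_le d x0 m C1"
    by (rule separator_cut[OF N U(7) SN(2) A(1) U(1-4,6) g(1) shell k(2) small bigA C(2)])
  have "m \<le> int (\<sigma> k)" using k(1) \<sigma>ge[of k] by linarith
  then have "asind_le d x0 (int (\<sigma> k)) C1" by (rule asind_le_mono[OF C1(2)])
  then show False using hard[of "\<sigma> k"] C1(1) by (simp add: hard_point_def)
qed

text \<open>Turns finiteness for each pair into a common bound. If no bound exists there is a hard
  point for every \<open>n\<close>, and the alternative is whether one of their cluster points is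
  hard for all \<open>n\<close>.\<close>

lemma finite_separators_imp_asind:
  assumes N: "net N"
    and sep: "\<And>x A. \<lbrakk>x \<in> cor N; A \<subseteq> N; x \<notin> tr N A\<rbrakk> \<Longrightarrow> \<exists>C n. asym_separator N d x0 x A C \<and> asind_le d x0 n C"
  shows "\<exists>n. asind_le d x0 n N"
proof (rule ccontr)
  assume no: "\<nexists>n. asind_le d x0 n N"
  have "\<exists>x A. hard_point N n x A" for n
  proof (rule ccontr)
    assume "\<nexists>x A. hard_point N n x A"
    then have "asind_le d x0 (int n + 1) N"
      by (intro asind_le.sep) (auto simp: hard_point_def)
    then show False using no by blast
  qed
  then obtain Y A where YA: "\<And>n. hard_point N n (Y n) (A n)" by metis
  then have "Y n \<in> cor N" for n by (auto simp: hard_point_def)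
  then obtain x where x: "x \<in> cor N"
    and cl: "\<And>\<phi> V m. \<lbrakk>\<phi> \<in> CH N; open V; x \<phi> \<in> V\<rbrakk> \<Longrightarrow> \<exists>n\<ge>m. Y n \<phi> \<in> V"
    using cor_cluster_point[OF N, of Y] by metis
  show False
  proof (cases "\<forall>n. \<exists>A. hard_point N n x A")
    case True
    then obtain A where "\<And>n. hard_point N n x (A n)" by metis
    then show False using single_hard_point_impossible[OF N sep] by blast
  next
    case False
    \<comment> \<open>From index \<open>n0\<close> on, hard points differ from \<open>x\<close>,
      because hardness passes down to smaller indices and \<open>x\<close> is not hard at
      \<open>n0\<close>.\<close>
    then obtain n0 where n0: "\<nexists>A. hard_point N n0 x A" by blast
    show False
    proof (rule hard_sequence_impossible[OF N sep])
      show "hard_point N n (Y (n0 + n)) (A (n0 + n))" for n using hard_point_antimono[OF YA] by simp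
      show "Y (n0 + n) \<noteq> x" for n using n0 hard_point_antimono[OF YA[of "n0 + n"], of n0] by auto
      show "\<exists>n\<ge>m. Y (n0 + n) \<phi> \<in> V" if "\<phi> \<in> CH N" "open V" "x \<phi> \<in> V" for \<phi> V m
      proof -
        obtain n where n: "n \<ge> n0 + m" "Y n \<phi> \<in> V" using cl \<open>\<phi> \<in> CH N\<close> \<open>open V\<close> \<open>x \<phi> \<in> V\<close> by blast
        then show ?thesis by (intro exI[of _ "n - n0"]) auto
      qed
    qed (use x in auto)
  qed
qed

text \<open>The order is used only for induction: it makes each separator finite-dimensional, with a
  bound that may depend on the pair, and the preceding result makes the bound uniform.\<close>

lemma net_trasind_imp_asind:
  assumes "trasind_le d x0 \<alpha> N" "net N"
  shows "\<exists>n. asind_le d x0 n N"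
  using assms
proof (induction rule: trasind_le.induct)
  case (bounded S \<alpha>)
  then show ?case using asind_le.bounded[of "-1" S d x0] by auto
next
  case (sep S \<alpha>)
  show ?case
  proof (rule finite_separators_imp_asind[OF sep.prems])
    fix x A assume "x \<in> cor S" "A \<subseteq> S" "x \<notin> tr S A"
    then obtain C where C: "asym_separator S d x0 x A C" "net C \<Longrightarrow> \<exists>n. asind_le d x0 n C"
      using sep.IH by blast
    then have "net C" using net_subset[OF sep.prems] by (simp add: asym_separator_def)
    then show "\<exists>C n. asym_separator S d x0 x A C \<and> asind_le d x0 n C" using C by blast
  qed
qed

end

section \<open>Passing between a space and its nets\<close>

lemma maximal_separated_subset:
  assumes "Metric_space X d"
  obtains N where "N \<subseteq> X" "\<And>s t. \<lbrakk>s \<in> N; t \<in> N; s \<noteq> t\<rbrakk> \<Longrightarrow> d s t \<ge> 1" "\<And>x. x \<in> X \<Longrightarrow> \<exists>u\<in>N. d x u < (1::real)"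
proof -
  interpret Metric_space X d by fact
  define \<A> where "\<A> = {N. N \<subseteq> X \<and> (\<forall>s\<in>N. \<forall>t\<in>N. s \<noteq> t \<longrightarrow> d s t \<ge> 1)}"
  have "\<exists>M\<in>\<A>. \<forall>N\<in>\<A>. M \<subseteq> N \<longrightarrow> N = M"
  proof (rule subset_Zorn_nonempty)
    show "\<A> \<noteq> {}" by (auto simp: \<A>_def)
    fix \<C> assume C: "\<C> \<noteq> {}" "subset.chain \<A> \<C>"
    have "d s t \<ge> 1" if ab: "A \<in> \<C>" "s \<in> A" "B \<in> \<C>" "t \<in> B" "s \<noteq> t" for A B s t
    proof -
      have "A \<subseteq> B \<or> B \<subseteq> A" using C that unfolding subset.chain_def by blast
      then obtain D where "D \<in> \<C>" "s \<in> D" "t \<in> D" using ab by blast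
      moreover have "D \<in> \<A>" using C(2) \<open>D \<in> \<C>\<close> by (auto simp: subset.chain_def)
      ultimately show ?thesis using \<open>s \<noteq> t\<close> by (simp add: \<A>_def)
    qed
    moreover have "\<Union>\<C> \<subseteq> X" using C unfolding subset.chain_def \<A>_def by blast
    ultimately show "\<Union>\<C> \<in> \<A>" unfolding \<A>_def by blast
  qed
  then obtain M where M: "M \<in> \<A>" "\<And>N. \<lbrakk>N \<in> \<A>; M \<subseteq> N\<rbrakk> \<Longrightarrow> N = M" by blast
  have "\<exists>u\<in>M. d x u < 1" if x: "x \<in> X" for x
  proof (rule ccontr)
    assume no: "\<not> (\<exists>u\<in>M. d x u < 1)"
    then have "insert x M \<in> \<A>" using M(1) x commute unfolding \<A>_def by (auto simp: not_less)
    then have "x \<in> M" using M(2) by blast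
    then show False using no x by auto
  qed
  moreover have "M \<subseteq> X" "\<And>s t. \<lbrakk>s \<in> M; t \<in> M; s \<noteq> t\<rbrakk> \<Longrightarrow> d s t \<ge> 1" using M(1) by (auto simp: \<A>_def)
  ultimately show thesis by (intro that[of M])
qed

context based_metric_space
begin

text \<open>Total boundedness covers a ball by finitely many balls of radius 1/2, and each of these
  contains at most one point of a 1-separated set.\<close>

lemma proper_separated_net:
  assumes proper: "proper_mspace X d" and NX: "N \<subseteq> X"
    and sep: "\<And>s t. \<lbrakk>s \<in> N; t \<in> N; s \<noteq> t\<rbrakk> \<Longrightarrow> d s t \<ge> 1"
  shows "net N"
proof -
  have "finite {s\<in>N. nm s \<le> R}" for R
  proof -
    have "mtotally_bounded (mcball x0 R)"
      using proper base_in compactin_imp_mtotally_bounded by (auto simp: proper_mspace_def)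
    then obtain K where K: "finite K" "K \<subseteq> mcball x0 R" "mcball x0 R \<subseteq> (\<Union>x\<in>K. mball x (1/2))"
      unfolding mtotally_bounded_def by (metis half_gt_zero zero_less_one)
    have fin: "finite (N \<inter> mball x (1/2))" for x
    proof (cases "N \<inter> mball x (1/2) = {}")
      case False
      then obtain s where s: "s \<in> N" "s \<in> mball x (1/2)" by blast
      have "t = s" if t: "t \<in> N" "t \<in> mball x (1/2)" for t
      proof (rule ccontr)
        assume "t \<noteq> s"
        then have "d t s \<ge> 1" using sep s t by blast
        moreover have "d t s \<le> d t x + d x s" using s t NX by (intro triangle) auto
        ultimately show False using s t commute[of t x] by auto
      qed
      then have "N \<inter> mball x (1/2) \<subseteq> {s}" by blast
      then show ?thesis using finite_subset by blast
    qed simp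
    have "{s\<in>N. nm s \<le> R} \<subseteq> mcball x0 R" using NX base_in commute by auto
    then have "{s\<in>N. nm s \<le> R} \<subseteq> (\<Union>x\<in>K. N \<inter> mball x (1/2))" using K(3) by blast
    then show ?thesis using fin K(1) finite_subset by blast
  qed
  then show ?thesis using NX sep by (auto simp: net_def)
qed

lemma proper_boundedly_compact: "proper_mspace X d \<Longrightarrow> boundedly_compact X"
proof -
  assume p: "proper_mspace X d"
  have "{s\<in>X. nm s \<le> R} = mcball x0 R" for R using base_in commute by auto
  then show ?thesis using p base_in by (simp add: boundedly_compact_def proper_mspace_def)
qed

section \<open>Shadows of subsets on a net\<close>

definition shadow :: "'a set \<Rightarrow> 'a set \<Rightarrow> 'a set" where
  "shadow N S = {u\<in>N. \<exists>s\<in>S. d u s < 1}"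

text \<open>Each of the two sets lies within distance 1 of the other; one direction is the
  definition, the other the density of \<open>N\<close>.\<close>

lemma asdisj_shadow:
  assumes N: "N \<subseteq> X" and cover: "\<And>x. x \<in> X \<Longrightarrow> \<exists>u\<in>N. d x u < 1" and X: "E \<subseteq> X" "S \<subseteq> X"
  shows "asdisj E (shadow N S) \<longleftrightarrow> asdisj E S"
proof
  have sh: "shadow N S \<subseteq> X" using N by (auto simp: shadow_def)
  show "asdisj E S" if "asdisj E (shadow N S)"
  proof (rule asdisj_near[OF that X(1) sh X(2), of 1])
    fix b assume b: "b \<in> S"
    then obtain u where u: "u \<in> N" "d b u < 1" using cover X by blast
    then have "u \<in> shadow N S" using b by (auto simp: shadow_def commute)
    then show "\<exists>c\<in>shadow N S. d b c \<le> 1" using u by (intro bexI[of _ u]) auto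
  qed
  show "asdisj E (shadow N S)" if "asdisj E S"
    by (rule asdisj_near[OF that X sh, of 1]) (auto simp: shadow_def intro: less_imp_le)
qed

text \<open>The subset \<open>S\<close> may be badly non-compact, so nothing is claimed about its
  whole corona: corona points of the shadow are sent to points at infinity of \<open>S\<close>, and
  the separators found there are pulled back. The shadow of a separator has the same trace as seen
  from the net, so the same \<beta> serves.\<close>

lemma trasind_shadow:
  assumes "trasind_le d x0 \<alpha> S" and "S \<subseteq> X" and N: "net N" and cover: "\<And>x. x \<in> X \<Longrightarrow> \<exists>u\<in>N. d x u < 1"
  shows "trasind_le d x0 \<alpha> (shadow N S)"
  using assms(1,2)
proof (induction rule: trasind_le.induct)
  case (bounded S \<alpha>)
  have sh: "shadow N S \<subseteq> X" using net_sub[OF N] by (auto simp: shadow_def)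
  obtain R where R: "\<forall>s\<in>S. nm s \<le> R" using bounded mbounded_iff_nm by blast
  have "nm u \<le> 1 + R" if u: "u \<in> shadow N S" for u
  proof -
    obtain s where s: "s \<in> S" "d u s < 1" using u by (auto simp: shadow_def)
    then show ?thesis using nm_triangle[of u s] u sh R bounded by fastforce
  qed
  then show ?case using mbounded_iff_nm[OF sh] by (intro trasind_le.bounded) blast
next
  case (sep S \<alpha>)
  let ?M = "shadow N S"
  have M: "net ?M" by (rule net_subset[OF N]) (auto simp: shadow_def)
  have MX: "?M \<subseteq> X" using net_sub M by blast
  have "\<exists>s. s \<in> S \<and> d u s \<le> 1" if "u \<in> ?M" for u using that by (force simp: shadow_def)
  \<comment> \<open>The shadow is usually not contained in \<open>S\<close>, so a choice of nearby
    points replaces the inclusion; \<open>A\<close> is transported accordingly to its image.\<close>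
  then obtain p where p: "\<And>u. u \<in> ?M \<Longrightarrow> p u \<in> S" "\<And>u. u \<in> ?M \<Longrightarrow> d u (p u) \<le> 1" by metis
  have cm: "close_map ?M S p 1" by (rule close_map_net[OF M sep.prems]) (use p in auto)
  show ?case
  proof (rule trasind_le.sep, intro allI impI, elim conjE)
    fix x A assume x: "x \<in> cor ?M" "A \<subseteq> ?M" "x \<notin> tr ?M A"
    let ?x = "corona_map ?M S p x"
    have ix: "at_infinity ?M x" using x net_cor_iff M by blast
    have pA: "p ` A \<subseteq> S" using p x by auto
    have pAX: "p ` A \<subseteq> X" "A \<subseteq> X" using pA sep.prems x MX by auto
    have eqA: "asdisj E A \<longleftrightarrow> asdisj E (p ` A)" if E: "E \<subseteq> ?M" for E
    proof
      have EX: "E \<subseteq> X" using E MX by blast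
      show "asdisj E (p ` A)" if "asdisj E A"
        by (rule asdisj_near[OF that EX pAX(2) pAX(1), of 1]) (use p(2) x commute in fastforce)
      show "asdisj E A" if "asdisj E (p ` A)"
        by (rule asdisj_near[OF that EX pAX, of 1]) (use p(2) x in auto)
    qed
    have "?x \<in> cor S" using corona_map_at_infinity[OF cm ix] at_infinity_corona sep.prems by blast
    moreover have "?x \<notin> tr S (p ` A)"
      using x(3) eqA unfolding corona_map_trace_iff[OF cm ix pA] trace_iff_asdisj[OF MX ix x(2)] by blast
    ultimately obtain C \<beta> where C: "\<beta> < \<alpha>" "asym_separator S d x0 ?x (p ` A) C"
        "C \<subseteq> X \<Longrightarrow> trasind_le d x0 \<beta> (shadow N C)"
      using sep.IH[rule_format, of ?x "p ` A"] pA by auto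
    have CS: "C \<subseteq> S" using C(2) by (simp add: asym_separator_def)
    then have CX: "C \<subseteq> X" using sep.prems by blast
    have "asym_separator ?M d x0 x A (shadow N C)"
    proof (rule separator_pullback[OF cm M x(2) pA CS _ eqA _ C(2) x(1)])
      show "shadow N C \<subseteq> ?M" using CS by (auto simp: shadow_def)
      show "asdisj E (shadow N C) \<longleftrightarrow> asdisj E C" if "E \<subseteq> ?M" for E
        using asdisj_shadow[OF net_sub[OF N] cover _ CX] that MX by blast
    qed
    then show "\<exists>C \<beta>. \<beta> < \<alpha> \<and> asym_separator ?M d x0 x A C \<and> trasind_le d x0 \<beta> C"
      using C(1) C(3)[OF CX] by blast
  qed
qed

text \<open>Only the top level has to be lifted: a separator \<open>C\<close> in \<open>N\<close> is
  used unchanged in \<open>X\<close>, and its dimension is intrinsic, hence no induction. Pushing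
  the partition forward requires the inclusion to induce a homeomorphism of coronas.\<close>

lemma asind_from_net:
  assumes asN: "asind_le d x0 n N" and N: "net N" and cover: "\<And>x. x \<in> X \<Longrightarrow> \<exists>u\<in>N. d x u < 1" and bcX: "boundedly_compact X"
  shows "asind_le d x0 n X"
  using asN
proof cases
  case bounded
  have NX: "N \<subseteq> X" using N net_sub by blast
  obtain R where R: "\<forall>s\<in>N. nm s \<le> R" using bounded mbounded_iff_nm[OF NX] by blast
  have "nm x \<le> 1 + R" if "x \<in> X" for x
  proof -
    obtain u where u: "u \<in> N" "d x u < 1" using cover[OF \<open>x \<in> X\<close>] by blast
    then show ?thesis using nm_triangle[of x u] that NX R by fastforce
  qed
  then have "mbounded X" using mbounded_iff_nm[of X] by blast
  then show ?thesis using bounded(1) by (rule asind_le.bounded[rotated])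
next
  case sep
  have NX: "N \<subseteq> X" using N net_sub by blast
  have cm: "close_map N X id 0" by (rule close_map_net[OF N order_refl]) (use NX in auto)
  let ?j = "corona_map N X id"
  let ?TN = "subtopology (cube N) (cor N)"
  let ?TX = "subtopology (cube X) (cor X)"
  have topX: "topspace ?TX = cor X" using cpt_subset_cube by (auto simp: higson_corona_def)
  have corX: "\<And>y. y \<in> cor X \<longleftrightarrow> at_infinity X y" using boundedly_compact_corona_at_infinity[OF bcX] at_infinity_corona by blast
  have jcor: "?j y \<in> cor X" if "y \<in> cor N" for y
    using that corona_map_at_infinity[OF cm] net_cor_iff[OF N] corX by blast
  \<comment> \<open>Density of \<open>N\<close> puts \<open>x\<close> in the closure of the embedded
    \<open>N\<close>, and the image of the compact \<open>cpt N\<close> is closed, so it contains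
    \<open>x\<close>. The radial functions correspond under the inclusion, which places the preimage
    at infinity.\<close>
  have surj: "\<exists>y\<in>cor N. ?j y = x" if x: "x \<in> cor X" for x
  proof -
    have ix: "at_infinity X x" using x corX by blast
    have xc: "x \<in> topspace (cube X)" using ix at_infinity_in_cube by blast
    have "x \<in> tr X N"
    proof (rule ccontr)
      assume "x \<notin> tr X N"
      then obtain E where E: "E \<subseteq> X" "eventually (\<lambda>u. u \<in> E) (point_filter X x)" "asdisj E N"
        using trace_iff_asdisj[OF order_refl ix NX] by blast
      obtain R where R: "\<And>a b. \<lbrakk>a \<in> E; b \<in> N; d a b \<le> 1\<rbrakk> \<Longrightarrow> nm a \<le> R" using E(3) unfolding asdisj_def by meson
      have bnd: "nm a \<le> R" if "a \<in> E" for a using cover[of a] R[of a] that E(1) by (meson less_imp_le subsetD)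
      have "eventually (\<lambda>u. False) (point_filter X x)"
        using E(2) at_infinity_far[OF order_refl ix, of R] by eventually_elim (use bnd in force)
      then show False using at_infinity_nonbot[OF ix] by (simp add: trivial_limit_def)
    qed
    then have cl: "x \<in> cube X closure_of (emb X ` N)"
      using corona_trace_iff[OF NX] in_closure_emb_iff[OF xc NX] by blast
    have "compactin (cube N) (cpt N)"
      by (rule closedin_compact_space[OF compact_cube]) (simp add: higson_compact_def)
    then have "compactin (cube X) (?j ` cpt N)" using image_compactin corona_map_continuous[OF cm] by blast
    then have closed: "closedin (cube X) (?j ` cpt N)" using compactin_imp_closedin Hausdorff_cube by blast
    have "emb X s \<in> ?j ` cpt N" if s: "s \<in> N" for s
    proof -
      have "?j (emb N s) \<phi> = emb X s \<phi>" for \<phi>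
        using s cm by (simp add: corona_map_def higson_emb_def close_map_def)
      then have "emb X s = ?j (emb N s)" by (rule ext[symmetric])
      then show ?thesis using emb_in_cpt[OF s] by blast
    qed
    then have "emb X ` N \<subseteq> ?j ` cpt N" by blast
    then have "x \<in> ?j ` cpt N" using cl closure_of_minimal[OF _ closed] by blast
    then obtain y where y: "y \<in> cpt N" "?j y = x" by blast
    have "(\<lambda>u\<in>N. radial X (id u)) = radial N" using NX by (intro ext) (auto simp: radial_def restrict_def)
    then have "y (radial N) = x (radial X)" using y(2) radial_in_Ch[of X] by (auto simp: corona_map_def)
    then have "at_infinity N y" using y ix by (simp add: at_infinity_def)
    then show ?thesis using y net_cor_iff[OF N] by blast
  qed
  \<comment> \<open>A Higson function on \<open>N\<close> need not come with an extension to
    \<open>X\<close>, so injectivity goes through traces: a superlevel set of \<open>v\<close> has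
    \<open>z\<close> in its trace but not \<open>y\<close>, and \<open>corona_map_trace_iff\<close>
    carries both facts to \<open>X\<close>.\<close>
  have inj: "inj_on ?j (cor N)"
  proof (rule inj_onI, rule ccontr)
    fix y z assume yz: "y \<in> cor N" "z \<in> cor N" "?j y = ?j z" "y \<noteq> z"
    then obtain v where v: "v \<in> CH N" "y v = 0" "z v > 0" using cor_separating_function[OF N yz(1,2)] by metis
    define a where "a = z v"
    define E where "E = {s\<in>N. v s \<le> a / 3}"
    define F where "F = {s\<in>N. v s \<ge> a / 2}"
    have a: "a > 0" using v by (simp add: a_def)
    have ad: "asdisj E F" unfolding E_def F_def by (rule asdisj_gap(1)[OF NX v(1)]) (use a in simp)
    have FX: "F \<subseteq> X" "F \<subseteq> N" "E \<subseteq> N" using NX by (auto simp: E_def F_def)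
    have "eventually (\<lambda>s. v s < a/3) (point_filter N y)"
      by (rule order_tendstoD(2)[OF cor_tendsto[OF yz(1) v(1)]]) (use a v in simp)
    then have "eventually (\<lambda>s. s \<in> E) (point_filter N y)" using eventually_point_filter_in[of N y]
      by eventually_elim (simp add: E_def)
    then have "?j y \<notin> tr X F"
      using corona_map_trace_iff[OF cm _ FX(1)] net_cor_iff[OF N] yz(1) ad FX(3) by blast
    moreover have "z \<in> tr N F"
      by (rule trace_shell[OF N FX(2) yz(2) v(1), of "a/2" "a + 1" 0]) (use a in \<open>auto simp: F_def a_def\<close>)
    then have "?j z \<in> tr X F"
      using corona_map_trace_iff[OF cm _ FX(1)] trace_iff_asdisj[OF NX _ FX(2)] net_cor_iff[OF N] yz(2) by blast
    ultimately show False using yz(3) by simp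
  qed
  have cont: "continuous_map ?TN ?TX ?j"
    using continuous_map_from_subtopology[OF corona_map_continuous[OF cm]] jcor compact_cor(2)[OF N]
    by (auto simp: continuous_map_in_subtopology)
  have "homeomorphic_map ?TN ?TX ?j"
  proof (rule continuous_imp_homeomorphic_map[OF cont compact_cor(1)[OF N]])
    show "Hausdorff_space ?TX" using Hausdorff_cube Hausdorff_space_subtopology by blast
    show "?j ` topspace ?TN = topspace ?TX" unfolding compact_cor(2)[OF N] topX using jcor surj by blast
    show "inj_on ?j (topspace ?TN)" unfolding compact_cor(2)[OF N] by (rule inj)
  qed
  then have open_j: "open_map ?TN ?TX ?j" using homeomorphic_imp_open_map by blast
  show ?thesis
  proof (rule asind_le.sep[OF sep(1)], intro allI impI, elim conjE)
    fix x A assume x: "x \<in> cor X" "A \<subseteq> X" "x \<notin> tr X A"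
    obtain y where y: "y \<in> cor N" "?j y = x" using surj x by blast
    \<comment> \<open>\<open>A\<close> may miss \<open>N\<close> altogether; its shadow has the
      corresponding trace on the corona of \<open>N\<close>.\<close>
    let ?A = "shadow N A"
    have AN: "?A \<subseteq> N" by (auto simp: shadow_def)
    have trA: "?j z \<in> tr X A \<longleftrightarrow> z \<in> tr N ?A" if "z \<in> cor N" for z
    proof -
      have iz: "at_infinity N z" using that net_cor_iff[OF N] by blast
      have "\<And>E. E \<subseteq> N \<Longrightarrow> asdisj E ?A \<longleftrightarrow> asdisj E A" using asdisj_shadow[OF NX cover _ x(2)] NX by blast
      then show ?thesis unfolding corona_map_trace_iff[OF cm iz x(2)] trace_iff_asdisj[OF NX iz AN] by blast
    qed
    obtain C where C: "asym_separator N d x0 y ?A C" "asind_le d x0 (n - 1) C"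
      using sep(2) y AN trA[OF y(1)] x(3) by blast
    obtain U1 U2 where U: "openin ?TN U1" "openin ?TN U2" "U1 \<inter> U2 = {}" "cor N - tr N C = U1 \<union> U2"
        "{y} \<subseteq> U1" "tr N ?A \<subseteq> U2" "C \<subseteq> N"
      using C(1) unfolding asym_separator_def is_partition_def by blast
    have CX: "C \<subseteq> X" using U(7) NX by blast
    have trC: "?j z \<in> tr X C \<longleftrightarrow> z \<in> tr N C" if "z \<in> cor N" for z
      using corona_map_trace_iff[OF cm _ CX] trace_iff_asdisj[OF NX _ U(7)] net_cor_iff[OF N] that by blast
    have Usub: "U1 \<subseteq> cor N" "U2 \<subseteq> cor N" using U(4) by auto
    have "openin ?TX (?j ` U1)" "openin ?TX (?j ` U2)" using open_j U by (auto simp: open_map_def)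
    moreover have "?j ` U1 \<inter> ?j ` U2 = {}" using inj_on_image_Int[OF inj Usub] U(3) by auto
    moreover have "cor X - tr X C = ?j ` U1 \<union> ?j ` U2"
    proof
      show "cor X - tr X C \<subseteq> ?j ` U1 \<union> ?j ` U2" using surj trC U(4) by blast
      show "?j ` U1 \<union> ?j ` U2 \<subseteq> cor X - tr X C" using jcor trC U(4) by blast
    qed
    moreover have "{x} \<subseteq> ?j ` U1" using U(5) y(2) by blast
    moreover have "tr X A \<subseteq> ?j ` U2"
    proof
      fix w assume w: "w \<in> tr X A"
      then obtain z where "z \<in> cor N" "?j z = w" using surj trace_subset_cor by blast
      then show "w \<in> ?j ` U2" using trA U(6) w by blast
    qed
    moreover have "tr X C \<subseteq> cor X" by (rule trace_subset_cor)
    ultimately have "is_partition (cube X) (cor X) {x} (tr X A) (tr X C)"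
      unfolding is_partition_def by blast
    then show "\<exists>C. asym_separator X d x0 x A C \<and> asind_le d x0 (n - 1) C"
      using C(2) CX by (auto simp: asym_separator_def)
  qed
qed

end

theorem theorem1:
  fixes X :: "'a set" and d :: "'a \<Rightarrow> 'a \<Rightarrow> real" and x0 :: 'a
    and \<alpha> :: "'o::wellorder"
  assumes "proper_mspace X d"
    and "x0 \<in> X"
    and "trasind_le d x0 \<alpha> X"
  shows "\<exists>n::int. asind_le d x0 n X"
proof -
  have M: "Metric_space X d" using assms(1) by (simp add: proper_mspace_def)
  interpret based_metric_space X d x0
    using M assms(2) by (simp add: based_metric_space_def based_metric_space_axioms_def)
  obtain N where N: "N \<subseteq> X" "\<And>s t. \<lbrakk>s \<in> N; t \<in> N; s \<noteq> t\<rbrakk> \<Longrightarrow> d s t \<ge> 1" "\<And>x. x \<in> X \<Longrightarrow> \<exists>u\<in>N. d x u < 1"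
    using maximal_separated_subset[OF M] by metis
  have net: "net N" using proper_separated_net[OF assms(1) N(1,2)] by blast
  have "shadow N X = N" using N(1) by (force simp: shadow_def)
  then have "trasind_le d x0 \<alpha> N"
    using trasind_shadow[OF assms(3) order_refl net N(3)] by simp
  then obtain n where "asind_le d x0 n N" using net_trasind_imp_asind[OF _ net] by blast
  then have "asind_le d x0 n X" using asind_from_net[OF _ net N(3) proper_boundedly_compact[OF assms(1)]] by blast
  then show ?thesis by blast
qed

end
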